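(* Let $I$ be a finite set with $|I|=n$ and let $\alpha$ be a composition of $n$, so that $\mathcal{O}_{\alpha}=\mathcal{O}_{\alpha,I}\in\overline{\mathrm{OP}}[I]$. If $I=S\sqcup T$, then $$\Delta_{S,T}(\mathcal{O}_{\alpha})=(\mathcal{O}_{\alpha|_S},\mathcal{O}_{\alpha/_S}),$$ where $\alpha|_S$ and $\alpha/_S$ are the unique pair of compositions satisfying (i) $\alpha|_S$ is a composition of $|S|$ and $\alpha/_S$ is a composition of $|T|$, and (ii) either $\alpha|_S\cdot\alpha/_S=\alpha$ or $\alpha|_S\odot\alpha/_S=\alpha$. Here $\mathcal{O}_{\alpha|_S}$ lives in $\overline{\mathrm{OP}}[S]$ and $\mathcal{O}_{\alpha/_S}$ in $\overline{\mathrm{OP}}[T]$.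
   Context: Compositions. A composition of $n\ge 0$ is a finite sequence of positive integers with sum $n$; $\varnothing$ is the unique composition of $0$. For $\beta=(\beta_1,\dots,\beta_k)$ and $\gamma=(\gamma_1,\dots,\gamma_\ell)$, the concatenation is $\beta\cdot\gamma=(\beta_1,\dots,\beta_k,\gamma_1,\dots,\gamma_\ell)$, and for nonempty $\beta,\gamma$ the near-concatenation is $\beta\odot\gamma=(\beta_1,\dots,\beta_{k-1},\beta_k+\gamma_1,\gamma_2,\dots,\gamma_\ell)$. Orbit polytopes. For a finite set $I$, $\mathbb{R}I$ is the real vector space with basis $\{e_i:i\in I\}$ and $\mathbb{R}^I$ its dual. $\mathfrak{S}_I$ acts on $\mathbb{R}I$ by $\sigma(p)_i=p_{\sigma^{-1}(i)}$; the orbit polytope of $p\in\mathbb{R}I$ is $\mathcal{O}(p)=\operatorname{conv}\{\sigma(p):\sigma\in\mathfrak{S}_I\}$. The composition of a point $p\in\mathbb{R}I$ is $(\alpha_1,\dots,\alpha_k)$, where $\alpha_j$ is the number of coordinates of $p$ equal to the $j$-th largest distinct coordinate value; all vertices of an orbit polytope have the same composition, called the composition of the orbit polytope. For a face $F\le P$, $\mathcal{N}_P(F)$ is the cone of $y\in\mathbb{R}^I$ attaining their maximum over $P$ at every point of $F$; $P,Q$ are normally equivalent if their normal fans $\{\mathcal{N}_P(F):F\le P\}$ and $\{\mathcal{N}_Q(F):F\le Q\}$ coincide. Two orbit polytopes in $\mathbb{R}I$ are normally equivalent iff they have the same composition; $\mathcal{O}_{\alpha,I}$ denotes the normal equivalence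 class of orbit polytopes in $\mathbb{R}I$ with composition $\alpha$. Coproduct. For polytopes $P\subset\mathbb{R}S$, $Q\subset\mathbb{R}T$, $S\cap T=\varnothing$, $P\cdot Q=\{(p,q):p\in P,q\in Q\}\subset\mathbb{R}(S\sqcup T)$. $\overline{\mathrm{OP}}[I]$ is the set of normal equivalence classes of finite products of orbit polytopes lying in $\mathbb{R}I$. For $I=S\sqcup T$ and $P$ a finite product of orbit polytopes in $\mathbb{R}I$, the face of $P$ maximizing $\mathbf{1}_S(x)=\sum_{s\in S}x_s$ is uniquely of the form $P|_S\cdot P/_S$ with $P|_S\subset\mathbb{R}S$, $P/_S\subset\mathbb{R}T$ finite products of orbit polytopes. The coproduct $\Delta_{S,T}:\overline{\mathrm{OP}}[I]\to\overline{\mathrm{OP}}[S]\times\overline{\mathrm{OP}}[T]$ is induced by $P\mapsto(P|_S,P/_S)$, which is well defined on normal equivalence classes. *)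

theory Defs
  imports "HOL-Analysis.Analysis" "HOL-Analysis.Finite_Function_Topology"
begin

subsection \<open>Compositions\<close>

definition is_composition :: "nat \<Rightarrow> nat list \<Rightarrow> bool" where
  "is_composition n \<alpha> \<longleftrightarrow> (\<forall>a\<in>set \<alpha>. 0 < a) \<and> sum_list \<alpha> = n"

text \<open>Concatenation of compositions is \<open>@\<close>. Near-concatenation is meaningful
  only for nonempty arguments; its uses carry that condition explicitly.\<close>

definition near_concat :: "nat list \<Rightarrow> nat list \<Rightarrow> nat list" where
  "near_concat \<beta> \<gamma> = butlast \<beta> @ (last \<beta> + hd \<gamma>) # tl \<gamma>"

definition splits_composition :: "nat list \<Rightarrow> nat \<Rightarrow> nat \<Rightarrow> nat list \<Rightarrow> nat list \<Rightarrow> bool" where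
  "splits_composition \<alpha> s t \<beta> \<gamma> \<longleftrightarrow>
     is_composition s \<beta> \<and> is_composition t \<gamma> \<and>
     (\<beta> @ \<gamma> = \<alpha> \<or> (\<beta> \<noteq> [] \<and> \<gamma> \<noteq> [] \<and> near_concat \<beta> \<gamma> = \<alpha>))"


subsection \<open>The spaces \<open>\<real>I\<close> and \<open>\<real>\<^sup>I\<close>\<close>

text \<open>\<open>\<real>I\<close> is realised inside the free real vector space on the ambient type, so that all the
  spaces \<open>\<real>S\<close> with \<open>S \<subseteq> I\<close> are subspaces of one and the same vector space. The
  basis vector \<open>e\<^sub>i\<close> is \<open>Poly_Mapping.single i 1\<close>.\<close>

definition point_space :: "'a set \<Rightarrow> ('a \<Rightarrow>\<^sub>0 real) set" where
  "point_space I = {p. Poly_Mapping.keys p \<subseteq> I}"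

text \<open>The dual space \<open>\<real>\<^sup>I\<close>, in coordinates, consists of the functions in \<open>I \<rightarrow>\<^sub>E UNIV\<close>;
  they act on \<open>\<real>I\<close> as follows.\<close>

definition pairing :: "'a set \<Rightarrow> ('a \<Rightarrow> real) \<Rightarrow> ('a \<Rightarrow>\<^sub>0 real) \<Rightarrow> real" where
  "pairing I y x = (\<Sum>i\<in>I. y i * Poly_Mapping.lookup x i)"


subsection \<open>Orbit polytopes\<close>

definition perm_act :: "('a \<Rightarrow> 'a) \<Rightarrow> ('a \<Rightarrow>\<^sub>0 real) \<Rightarrow> ('a \<Rightarrow>\<^sub>0 real)" where
  "perm_act \<sigma> p = Poly_Mapping.map_key (inv \<sigma>) p"

definition orbit_polytope :: "'a set \<Rightarrow> ('a \<Rightarrow>\<^sub>0 real) \<Rightarrow> ('a \<Rightarrow>\<^sub>0 real) set" where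
  "orbit_polytope I p = convex hull {perm_act \<sigma> p | \<sigma>. \<sigma> permutes I}"

definition orbit_polytopes :: "'a set \<Rightarrow> ('a \<Rightarrow>\<^sub>0 real) set set" where
  "orbit_polytopes I = orbit_polytope I ` point_space I"

definition point_composition :: "'a set \<Rightarrow> ('a \<Rightarrow>\<^sub>0 real) \<Rightarrow> nat list" where
  "point_composition I p =
     map (\<lambda>v. card {i \<in> I. Poly_Mapping.lookup p i = v})
       (rev (sorted_list_of_set (Poly_Mapping.lookup p ` I)))"

definition has_composition :: "'a set \<Rightarrow> ('a \<Rightarrow>\<^sub>0 real) set \<Rightarrow> nat list \<Rightarrow> bool" where
  "has_composition I P \<alpha> \<longleftrightarrow> (\<forall>v. v extreme_point_of P \<longrightarrow> point_composition I v = \<alpha>)"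


subsection \<open>Products of orbit polytopes and normal equivalence\<close>

text \<open>For \<open>P \<subseteq> \<real>S\<close> and \<open>Q \<subseteq> \<real>T\<close> with \<open>S\<close>, \<open>T\<close> disjoint, the point \<open>(p, q)\<close> of
  \<open>\<real>(S \<union> T)\<close> is \<open>p + q\<close>.\<close>

definition poly_prod ::
    "('a \<Rightarrow>\<^sub>0 real) set \<Rightarrow> ('a \<Rightarrow>\<^sub>0 real) set \<Rightarrow> ('a \<Rightarrow>\<^sub>0 real) set" where
  "poly_prod P Q = {p + q | p q. p \<in> P \<and> q \<in> Q}"

text \<open>The empty product \<open>{0}\<close> in \<open>\<real>\<emptyset>\<close> needs no rule of its own: it is the orbit
  polytope of \<open>0\<close> in \<open>\<real>\<emptyset>\<close>.\<close>

inductive orbit_product :: "'a set \<Rightarrow> ('a \<Rightarrow>\<^sub>0 real) set \<Rightarrow> bool" where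
  orbit: "finite I \<Longrightarrow> P \<in> orbit_polytopes I \<Longrightarrow> orbit_product I P"
| prod: "orbit_product S P \<Longrightarrow> orbit_product T Q \<Longrightarrow> S \<inter> T = {} \<Longrightarrow>
           orbit_product (S \<union> T) (poly_prod P Q)"

definition normal_cone ::
    "'a set \<Rightarrow> ('a \<Rightarrow>\<^sub>0 real) set \<Rightarrow> ('a \<Rightarrow>\<^sub>0 real) set \<Rightarrow> ('a \<Rightarrow> real) set" where
  "normal_cone I P F =
     {y \<in> I \<rightarrow>\<^sub>E UNIV. \<forall>x\<in>F. \<forall>z\<in>P. pairing I y z \<le> pairing I y x}"

text \<open>In the library the empty set is a face of every convex set; as usual it contributes no
  cone to the normal fan.\<close>

definition normal_fan :: "'a set \<Rightarrow> ('a \<Rightarrow>\<^sub>0 real) set \<Rightarrow> ('a \<Rightarrow> real) set set" where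
  "normal_fan I P = {normal_cone I P F | F. F face_of P \<and> F \<noteq> {}}"

definition normal_equiv ::
    "'a set \<Rightarrow> (('a \<Rightarrow>\<^sub>0 real) set \<times> ('a \<Rightarrow>\<^sub>0 real) set) set" where
  "normal_equiv I =
     {(P, Q). orbit_product I P \<and> orbit_product I Q \<and> normal_fan I P = normal_fan I Q}"

definition normal_class ::
    "'a set \<Rightarrow> ('a \<Rightarrow>\<^sub>0 real) set \<Rightarrow> ('a \<Rightarrow>\<^sub>0 real) set set" where
  "normal_class I P = normal_equiv I `` {P}"

definition OP_bar :: "'a set \<Rightarrow> ('a \<Rightarrow>\<^sub>0 real) set set set" where
  "OP_bar I = {P. orbit_product I P} // normal_equiv I"

text \<open>The class of the orbit polytopes in \<open>\<real>I\<close> with composition \<open>\<alpha>\<close>. As orbit polytopes with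
  the same composition are normally equivalent, the image below is a single equivalence class.\<close>

definition orbit_class :: "'a set \<Rightarrow> nat list \<Rightarrow> ('a \<Rightarrow>\<^sub>0 real) set set" where
  "orbit_class I \<alpha> = normal_equiv I `` {P \<in> orbit_polytopes I. has_composition I P \<alpha>}"


subsection \<open>Coproduct\<close>

definition max_face :: "'a set \<Rightarrow> ('a \<Rightarrow>\<^sub>0 real) set \<Rightarrow> ('a \<Rightarrow>\<^sub>0 real) set" where
  "max_face S P =
     {x \<in> P. \<forall>z\<in>P. (\<Sum>s\<in>S. Poly_Mapping.lookup z s) \<le> (\<Sum>s\<in>S. Poly_Mapping.lookup x s)}"

text \<open>The pair \<open>(P|\<^sub>S, P/\<^sub>S)\<close>.\<close>

definition split_face ::
    "'a set \<Rightarrow> 'a set \<Rightarrow> ('a \<Rightarrow>\<^sub>0 real) set \<Rightarrow> ('a \<Rightarrow>\<^sub>0 real) set \<times> ('a \<Rightarrow>\<^sub>0 real) set" where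
  "split_face S T P =
     (THE (A, B). orbit_product S A \<and> orbit_product T B \<and> max_face S P = poly_prod A B)"

text \<open>The map induced on classes: \<open>the_elem\<close> selects the common value of the
  pair of classes over all representatives of \<open>C\<close>.\<close>

definition coproduct ::
    "'a set \<Rightarrow> 'a set \<Rightarrow> ('a \<Rightarrow>\<^sub>0 real) set set \<Rightarrow>
       ('a \<Rightarrow>\<^sub>0 real) set set \<times> ('a \<Rightarrow>\<^sub>0 real) set set" where
  "coproduct S T C =
     the_elem ((\<lambda>P. (normal_class S (fst (split_face S T P)),
                     normal_class T (snd (split_face S T P)))) ` C)"

end

theory Submission
  imports Defs
begin

text \<open>Two polytopes have the same normal fan iff the inclusions between the faces maximizing two
  functionals \<open>y\<close>, \<open>z\<close> are the same for both; this uses that faces of polytopes are exposed (Farkas).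
  The vertices of \<open>O(p)\<close> maximizing \<open>y\<close> are the rearrangements of \<open>p\<close> ordered like \<open>y\<close>, so the fan
  of \<open>O(p)\<close> depends only on the composition of \<open>p\<close>. For \<open>y = 1\<^sub>S\<close> the maximal face consists of the
  rearrangements with the \<open>|S|\<close> largest coordinates on \<open>S\<close>: the run of equal values straddling position
  \<open>|S|\<close>, if there is one, is what turns concatenation into near-concatenation. On other representatives
  of the class one uses that, for large \<open>N\<close>, the face of the maximal face in direction \<open>y\<close> is the
  face of the whole polytope in direction \<open>N \<cdot> 1\<^sub>S + y\<close>, so its fan is determined by the class.\<close>

subsection \<open>Maximizing faces of convex hulls of finite sets\<close>

text \<open>The obstacle is that a normal equivalence class contains more than orbit polytopes: on a
  two-element \<open>I\<close>, the product of the points with coordinates 1 and 2 on the two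
  singletons has the fan of a one-point orbit polytope without being an orbit polytope. Hence
  existence and uniqueness of the factorization of the maximal face, and invariance of the fans of
  its factors, are needed for all products. Comparing inclusions rather than cones fits the
  perturbation: the bound on \<open>N\<close> depends on the direction, but an inclusion involves
  just two directions, so a single \<open>N\<close> can serve both of them and both polytopes.
  Exposedness enters because the fan is indexed by all nonempty faces, while linear functionals
  produce only exposed ones. Points are handled through the multiset of their coordinates: splitting
  \<open>I\<close> becomes addition of multisets, and a composition records a multiset up to
  strictly increasing relabelling of its values.\<close>

definition maximizers :: "('v \<Rightarrow> real) \<Rightarrow> 'v set \<Rightarrow> 'v set" where
  "maximizers f P = {x \<in> P. \<forall>z\<in>P. f z \<le> f x}"

lemma maximizers_subset: "maximizers f P \<subseteq> P"
  by (auto simp: maximizers_def)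

lemma maximizers_nonempty:
  assumes "finite V" "V \<noteq> {}"
  shows "maximizers f V \<noteq> {}"
proof -
  have "finite (f ` V)" "f ` V \<noteq> {}" using assms by auto
  then obtain v where "v \<in> V" "f v = Max (f ` V)"
    using Max_in[of "f ` V"] by (metis imageE)
  then have "v \<in> maximizers f V" using assms(1) by (simp add: maximizers_def)
  then show ?thesis by blast
qed

lemma maximizers_cong:
  assumes "\<And>x. x \<in> P \<Longrightarrow> f x = g x"
  shows "maximizers f P = maximizers g P"
  using assms by (auto simp: maximizers_def)

lemma maximizers_eq_level:
  assumes "x \<in> maximizers f P"
  shows "maximizers f P = {z \<in> P. f z = f x}"
  using assms by (force simp: maximizers_def)

text \<open>Write a point \<open>x\<close> of \<open>F\<close> as a convex combination of
  \<open>V\<close>. A generator \<open>v\<close> of positive weight lies in \<open>F\<close>: either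
  \<open>x = v\<close>, or \<open>x\<close> lies in the open segment between \<open>v\<close> and
  the renormalized rest \<open>w\<close> of the combination, and the face property applies.\<close>

lemma face_of_finite_hull:
  fixes V :: "'v::real_vector set"
  assumes "finite V" "F face_of convex hull V"
  shows "F = convex hull (V \<inter> F)"
proof
  show "convex hull (V \<inter> F) \<subseteq> F"
    using assms(2) by (intro hull_minimal) (auto simp: face_of_def)
  show "F \<subseteq> convex hull (V \<inter> F)"
  proof
    fix x assume x: "x \<in> F"
    then have "x \<in> convex hull V" using assms(2) by (auto simp: face_of_def)
    then obtain u where u: "\<And>v. v \<in> V \<Longrightarrow> 0 \<le> u v" "sum u V = 1" "(\<Sum>v\<in>V. u v *\<^sub>R v) = x"
      using convex_hull_finite[OF assms(1)] by auto
    have inF: "v \<in> F" if v: "v \<in> V" "u v > 0" for v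
    proof (cases "u v = 1")
      case True
      have "sum u (V - {v}) = 0"
        using u(2) v assms(1) True by (simp add: sum_diff1)
      then have "\<forall>w\<in>V - {v}. u w = 0"
        using u(1) assms(1) by (subst (asm) sum_nonneg_eq_0_iff) auto
      then have "(\<Sum>w\<in>V - {v}. u w *\<^sub>R w) = 0" by simp
      then have "x = v"
        using u(3) sum.remove[OF assms(1) v(1), of "\<lambda>w. u w *\<^sub>R w"] True by simp
      then show ?thesis using x by simp
    next
      case False
      have s: "sum u (V - {v}) = 1 - u v"
        using u(2) v assms(1) by (simp add: sum_diff1)
      moreover have "sum u (V - {v}) \<ge> 0" using u(1) by (auto intro: sum_nonneg)
      ultimately have lt: "u v < 1" using False by simp
      define w where "w = (\<Sum>z\<in>V - {v}. (u z / (1 - u v)) *\<^sub>R z)"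
      have w: "w \<in> convex hull V"
        unfolding w_def
      proof (rule convex_sum)
        show "(\<Sum>z\<in>V - {v}. u z / (1 - u v)) = 1"
          using s lt by (simp add: sum_divide_distrib[symmetric])
      qed (use u(1) lt assms(1) in \<open>auto simp: hull_inc\<close>)
      have "(1 - u v) *\<^sub>R w = (\<Sum>z\<in>V - {v}. u z *\<^sub>R z)"
        using lt by (simp add: w_def scaleR_sum_right)
      then have xe: "x = (1 - u v) *\<^sub>R w + u v *\<^sub>R v"
        using u(3) sum.remove[OF assms(1) v(1), of "\<lambda>w. u w *\<^sub>R w"]
        by (simp add: add.commute)
      show ?thesis
      proof (cases "w = v")
        case True
        then have "x = v" using xe by (simp add: algebra_simps)
        then show ?thesis using x by simp
      next
        case False
        then have "x \<in> open_segment w v"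
          using xe lt v by (auto simp: in_segment)
        moreover have "v \<in> convex hull V" using v by (simp add: hull_inc)
        ultimately show ?thesis using assms(2) x w by (auto simp: face_of_def)
      qed
    qed
    have z: "u v = 0" if "v \<in> V - V \<inter> F" for v
      using that inF u(1)[of v] by force
    have "sum u (V \<inter> F) = sum u V" "(\<Sum>v\<in>V \<inter> F. u v *\<^sub>R v) = (\<Sum>v\<in>V. u v *\<^sub>R v)"
      using z by (intro sum.mono_neutral_left[OF assms(1)]; simp)+
    then have "sum u (V \<inter> F) = 1" "(\<Sum>v\<in>V \<inter> F. u v *\<^sub>R v) = x" using u by simp_all
    moreover have "(\<Sum>v\<in>V \<inter> F. u v *\<^sub>R v) \<in> convex hull (V \<inter> F)"
      using u(1) calculation(1) assms(1) by (intro convex_sum) (auto simp: hull_inc)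
    ultimately show "x \<in> convex hull (V \<inter> F)" by simp
  qed
qed

lemma linear_le_on_hull:
  fixes f :: "'v::real_vector \<Rightarrow> real"
  assumes "linear f" "\<And>v. v \<in> V \<Longrightarrow> f v \<le> m" "x \<in> convex hull V"
  shows "f x \<le> m"
proof -
  interpret linear f by fact
  have "convex {x. f x \<le> m}"
  proof (rule convexI)
    fix x y :: 'v and u v :: real
    assume "x \<in> {x. f x \<le> m}" "y \<in> {x. f x \<le> m}" and uv: "0 \<le> u" "0 \<le> v" "u + v = 1"
    then have "u * f x + v * f y \<le> u * m + v * m"
      by (intro add_mono mult_left_mono) auto
    then show "u *\<^sub>R x + v *\<^sub>R y \<in> {x. f x \<le> m}"
      using uv by (simp add: add scale distrib_right[symmetric])
  qed
  then have "convex hull V \<subseteq> {x. f x \<le> m}"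
    using assms(2) by (intro hull_minimal) auto
  then show ?thesis using assms(3) by auto
qed

lemma maximizers_face_of:
  fixes f :: "'v::real_vector \<Rightarrow> real"
  assumes "linear f" "convex P"
  shows "maximizers f P face_of P"
proof -
  interpret linear f by fact
  have "convex (maximizers f P)"
  proof (rule convexI)
    fix x y :: 'v and u v :: real
    assume xy: "x \<in> maximizers f P" "y \<in> maximizers f P" and uv: "0 \<le> u" "0 \<le> v" "u + v = 1"
    then have "f y = f x" by (force simp: maximizers_def)
    then have "f (u *\<^sub>R x + v *\<^sub>R y) = (u + v) * f x"
      by (simp add: add scale distrib_right)
    then have "f (u *\<^sub>R x + v *\<^sub>R y) = f x" using uv by simp
    moreover have "u *\<^sub>R x + v *\<^sub>R y \<in> P"
      using xy uv assms(2) by (auto simp: maximizers_def convex_def)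
    ultimately show "u *\<^sub>R x + v *\<^sub>R y \<in> maximizers f P"
      using xy by (simp add: maximizers_def)
  qed
  moreover have "a \<in> maximizers f P \<and> b \<in> maximizers f P"
    if ab: "a \<in> P" "b \<in> P" and x: "x \<in> maximizers f P" "x \<in> open_segment a b" for a b x
  proof -
    obtain u where u: "0 < u" "u < 1" "x = (1 - u) *\<^sub>R a + u *\<^sub>R b"
      using x(2) by (auto simp: in_segment)
    have le: "f a \<le> f x" "f b \<le> f x" using x ab by (auto simp: maximizers_def)
    have fx: "f x = (1 - u) * f a + u * f b" using u by (simp add: add scale)
    have "(1 - u) * (f x - f a) + u * (f x - f b) = 0"
      using fx by (simp add: algebra_simps)
    moreover have "(1 - u) * (f x - f a) \<ge> 0" "u * (f x - f b) \<ge> 0" using le u by auto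
    ultimately have "(1 - u) * (f x - f a) = 0" "u * (f x - f b) = 0" by linarith+
    then have "f a = f x" "f b = f x" using u by auto
    then show ?thesis using x ab by (simp add: maximizers_def)
  qed
  ultimately show ?thesis
    unfolding face_of_def by (intro conjI[OF maximizers_subset] conjI ballI impI) metis+
qed

lemma maximizers_hull_Int:
  fixes f :: "'v::real_vector \<Rightarrow> real"
  assumes "linear f"
  shows "V \<inter> maximizers f (convex hull V) = maximizers f V"
proof (intro equalityI subsetI)
  fix x assume "x \<in> V \<inter> maximizers f (convex hull V)"
  then show "x \<in> maximizers f V" by (simp add: maximizers_def hull_inc)
next
  fix x assume "x \<in> maximizers f V"
  then show "x \<in> V \<inter> maximizers f (convex hull V)"
    using linear_le_on_hull[OF assms, of V "f x"] by (simp add: maximizers_def hull_inc)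
qed

lemma maximizers_hull:
  fixes f :: "'v::real_vector \<Rightarrow> real"
  assumes "linear f" "finite V"
  shows "maximizers f (convex hull V) = convex hull (maximizers f V)"
  using face_of_finite_hull[OF assms(2) maximizers_face_of[OF assms(1) convex_convex_hull]]
  unfolding maximizers_hull_Int[OF assms(1)] .

text \<open>Intersecting with \<open>V\<close> recovers the maximizers in \<open>V\<close> from
  those in the hull. Inclusions of faces thus become statements about finitely many points, which
  for orbit polytopes means about rearrangements.\<close>

lemma maximizers_hull_subset_iff:
  fixes f g :: "'v::real_vector \<Rightarrow> real"
  assumes "linear f" "linear g" "finite V"
  shows "maximizers f (convex hull V) \<subseteq> maximizers g (convex hull V) \<longleftrightarrow>
    maximizers f V \<subseteq> maximizers g V"
  using maximizers_hull[OF assms(1,3)] maximizers_hull[OF assms(2,3)]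
    maximizers_hull_Int[OF assms(1), of V] maximizers_hull_Int[OF assms(2), of V]
    hull_mono[of "maximizers f V" "maximizers g V" convex] by blast

lemma maximizers_poly_prod:
  assumes "\<And>p q. f (p + q) = f p + f q"
  shows "maximizers f (poly_prod P Q) = poly_prod (maximizers f P) (maximizers f Q)"
proof (intro equalityI subsetI)
  fix x assume "x \<in> maximizers f (poly_prod P Q)"
  then obtain p q where pq: "x = p + q" "p \<in> P" "q \<in> Q"
    and m: "\<And>z. z \<in> poly_prod P Q \<Longrightarrow> f z \<le> f x"
    by (auto simp: maximizers_def poly_prod_def)
  have "f p' \<le> f p" if "p' \<in> P" for p'
    using m[of "p' + q"] pq that assms by (auto simp: poly_prod_def)
  moreover have "f q' \<le> f q" if "q' \<in> Q" for q'
    using m[of "p + q'"] pq that assms by (auto simp: poly_prod_def)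
  ultimately show "x \<in> poly_prod (maximizers f P) (maximizers f Q)"
    using pq by (auto simp: maximizers_def poly_prod_def)
next
  fix x assume "x \<in> poly_prod (maximizers f P) (maximizers f Q)"
  then show "x \<in> maximizers f (poly_prod P Q)"
    using assms by (force simp: maximizers_def poly_prod_def intro: add_mono)
qed

text \<open>Once \<open>N * (f v - f w)\<close> exceeds \<open>g w - g v\<close> for each of the
  finitely many pairs in \<open>V\<close> with \<open>f w < f v\<close>, the functional
  \<open>f\<close> decides and \<open>g\<close> only breaks ties. The filter form lets several
  instances share one \<open>N\<close>.\<close>

lemma eventually_maximizers_perturb:
  fixes f g :: "'v::real_vector \<Rightarrow> real"
  assumes "linear f" "linear g" "finite V"
  shows "\<forall>\<^sub>F N in at_top. maximizers g (maximizers f (convex hull V)) =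
    maximizers (\<lambda>x. N * f x + g x) (convex hull V)"
proof -
  have "\<forall>\<^sub>F N in at_top. f w < f v \<longrightarrow> N * f w + g w < N * f v + g v" for v w
  proof (cases "f w < f v")
    case True
    have "\<forall>\<^sub>F N in at_top. (g w - g v) / (f v - f w) < N" by (rule eventually_gt_at_top)
    then show ?thesis
    proof eventually_elim
      case (elim N)
      then have "g w - g v < N * (f v - f w)" using True by (simp add: field_simps)
      then show ?case by (simp add: algebra_simps)
    qed
  qed simp
  then have "\<forall>\<^sub>F N in at_top. \<forall>v\<in>V. \<forall>w\<in>V. f w < f v \<longrightarrow> N * f w + g w < N * f v + g v"
    using assms(3) by (intro eventually_ball_finite ballI)
  then show ?thesis
  proof eventually_elim
    case (elim N)
    have lin: "linear (\<lambda>x. N * f x + g x)"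
      using assms(1,2) by (simp add: linear_iff algebra_simps)
    have "maximizers g (maximizers f V) = maximizers (\<lambda>x. N * f x + g x) V"
    proof (intro equalityI subsetI)
      fix x assume x: "x \<in> maximizers g (maximizers f V)"
      then have xV: "x \<in> V" and xf: "x \<in> maximizers f V" by (auto simp: maximizers_def)
      have "N * f z + g z \<le> N * f x + g x" if z: "z \<in> V" for z
      proof (cases "f z < f x")
        case True
        then show ?thesis using elim xV z by force
      next
        case False
        then have "f z = f x" using xf z by (force simp: maximizers_def)
        then have "z \<in> maximizers f V" using xf z by (simp add: maximizers_def)
        then show ?thesis using x \<open>f z = f x\<close> by (simp add: maximizers_def)
      qed
      then show "x \<in> maximizers (\<lambda>x. N * f x + g x) V" using xV by (simp add: maximizers_def)
    next
      fix x assume x: "x \<in> maximizers (\<lambda>x. N * f x + g x) V"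
      have xf: "x \<in> maximizers f V"
        using x elim by (force simp: maximizers_def)
      have "g z \<le> g x" if "z \<in> maximizers f V" for z
      proof -
        have "f z = f x" using maximizers_eq_level[OF xf] that by blast
        then show ?thesis using x that by (auto simp: maximizers_def)
      qed
      then show "x \<in> maximizers g (maximizers f V)" using xf by (simp add: maximizers_def)
    qed
    then show ?case
      using maximizers_hull[OF assms(1,3)] maximizers_hull[OF lin assms(3)]
        maximizers_hull[OF assms(2), of "maximizers f V"]
        finite_subset[OF maximizers_subset assms(3)] by metis
  qed
qed

subsection \<open>Faces are exposed\<close>

text \<open>Bartl's induction: if dropping the form \<open>a k\<close> destroys the implication, a witness
  \<open>x\<^sub>0\<close> with \<open>a k x\<^sub>0 = 1\<close> lets one eliminate \<open>a k\<close> from the other forms.\<close>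

lemma farkas:
  fixes a :: "'k \<Rightarrow> 'w::real_vector \<Rightarrow> real"
  assumes "finite K" "\<And>k. k \<in> K \<Longrightarrow> linear (a k)" "linear c"
    and "\<And>x. (\<And>k. k \<in> K \<Longrightarrow> a k x \<le> 0) \<Longrightarrow> c x \<le> 0"
  shows "\<exists>l. (\<forall>k\<in>K. 0 \<le> l k) \<and> (\<forall>x. c x = (\<Sum>k\<in>K. l k * a k x))"
  using assms
proof (induction K arbitrary: a c rule: finite_induct)
  case empty
  interpret linear c by fact
  have "c x = 0" for x using empty(3)[of x] empty(3)[of "- x"] by (simp add: neg)
  then show ?case by simp
next
  case (insert k K)
  interpret c: linear c by fact
  show ?case
  proof (cases "\<forall>x. (\<forall>j\<in>K. a j x \<le> 0) \<longrightarrow> c x \<le> 0")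
    case True
    then obtain l where "\<forall>j\<in>K. 0 \<le> l j" "\<forall>x. c x = (\<Sum>j\<in>K. l j * a j x)"
      using insert.IH[of a c] insert.prems by auto
    moreover have "(\<Sum>j\<in>K. (l(k := 0)) j * a j x) = (\<Sum>j\<in>K. l j * a j x)" for x
      using insert.hyps by (intro sum.cong) auto
    ultimately show ?thesis
      using insert.hyps by (intro exI[of _ "l(k := 0)"]) auto
  next
    case False
    then obtain x1 where x1: "\<And>j. j \<in> K \<Longrightarrow> a j x1 \<le> 0" "c x1 > 0" by force
    interpret k: linear "a k" using insert.prems by simp
    have pos: "a k x1 > 0" using insert.prems(3)[of x1] x1 by force
    define x0 where "x0 = (1 / a k x1) *\<^sub>R x1"
    have x0: "a j x0 \<le> 0" if "j \<in> K" for j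
    proof -
      interpret j: linear "a j" using insert.prems that by simp
      show ?thesis using x1(1)[OF that] pos by (simp add: x0_def j.scale divide_nonpos_pos)
    qed
    have kx0: "a k x0 = 1" using pos by (simp add: x0_def k.scale)
    have cx0: "c x0 > 0" using x1 pos by (simp add: x0_def c.scale)
    have lin: "linear (\<lambda>x. b x - b x0 * a k x)" if "linear b" for b :: "'w \<Rightarrow> real"
      using that k.linear_axioms by (simp add: linear_iff algebra_simps)
    have "\<exists>l. (\<forall>j\<in>K. 0 \<le> l j) \<and>
      (\<forall>x. c x - c x0 * a k x = (\<Sum>j\<in>K. l j * (a j x - a j x0 * a k x)))"
    proof (rule insert.IH)
      fix x assume neg: "\<And>j. j \<in> K \<Longrightarrow> a j x - a j x0 * a k x \<le> 0"
      \<comment> \<open>As \<open>a k x0 = 1\<close>, subtracting the multiple \<open>a k x\<close>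
        of \<open>x0\<close> moves \<open>x\<close> into the kernel of \<open>a k\<close>, where the
        constraint from \<open>k\<close> holds trivially and the original implication becomes
        applicable.\<close>
      have shift: "b (x - a k x *\<^sub>R x0) = b x - b x0 * a k x" if "linear b" for b :: "'w \<Rightarrow> real"
        using that by (simp add: linear_diff linear_scale)
      have "a j (x - a k x *\<^sub>R x0) \<le> 0" if "j \<in> insert k K" for j
        using that neg shift[OF insert.prems(1), of j] kx0 by auto
      then have "c (x - a k x *\<^sub>R x0) \<le> 0" using insert.prems(3) by blast
      then show "c x - c x0 * a k x \<le> 0" using shift[OF insert.prems(2)] by simp
    qed (use insert.prems lin in auto)
    then obtain l where l: "\<And>j. j \<in> K \<Longrightarrow> 0 \<le> l j"
      "\<And>x. c x - c x0 * a k x = (\<Sum>j\<in>K. l j * (a j x - a j x0 * a k x))" by auto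
    \<comment> \<open>Expanding the identity for the eliminated forms, everything multiplied by
      \<open>a k x\<close> is collected in this coefficient. It is nonnegative because
      \<open>c x0 > 0\<close> and each \<open>a j x0\<close> is nonpositive.\<close>
    define l' where "l' = l(k := c x0 - (\<Sum>j\<in>K. l j * a j x0))"
    have "(\<Sum>j\<in>K. l j * a j x0) \<le> 0"
      using l(1) x0 by (intro sum_nonpos) (auto simp: mult_nonneg_nonpos)
    then have "\<forall>j\<in>insert k K. 0 \<le> l' j" using l(1) cx0 by (auto simp: l'_def)
    moreover have "c x = (\<Sum>j\<in>insert k K. l' j * a j x)" for x
    proof -
      have "(\<Sum>j\<in>K. l' j * a j x) = (\<Sum>j\<in>K. l j * a j x)"
        using insert.hyps by (intro sum.cong) (auto simp: l'_def)
      moreover have "(\<Sum>j\<in>K. l j * (a j x - a j x0 * a k x)) =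
        (\<Sum>j\<in>K. l j * a j x) - (\<Sum>j\<in>K. l j * a j x0) * a k x"
        by (simp add: algebra_simps sum_subtractf sum_distrib_left)
      ultimately show ?thesis
        using l(2)[of x] insert.hyps by (simp add: l'_def algebra_simps)
    qed
    ultimately show ?thesis by blast
  qed
qed

section \<open>Coordinate spaces, the dual pairing and polytopes spanned by finitely many
  points\<close>

lemma lookup_scaleR [simp]: "Poly_Mapping.lookup (r *\<^sub>R x) i = r *\<^sub>R Poly_Mapping.lookup x i"
  by (simp add: scaleR_poly_mapping_def)

lemma lookup_eq_0_outside:
  "x \<in> point_space I \<Longrightarrow> i \<notin> I \<Longrightarrow> Poly_Mapping.lookup x i = 0"
  by (auto simp: point_space_def in_keys_iff)

lemma point_spaceI:
  "(\<And>i. i \<notin> I \<Longrightarrow> Poly_Mapping.lookup x i = 0) \<Longrightarrow> x \<in> point_space I"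
  by (force simp: point_space_def in_keys_iff)

lemma point_space_eqI:
  assumes "x \<in> point_space I" "y \<in> point_space I"
    and "\<And>i. i \<in> I \<Longrightarrow> Poly_Mapping.lookup x i = Poly_Mapping.lookup y i"
  shows "x = y"
  using assms lookup_eq_0_outside by (metis poly_mapping_eqI)

lemma convex_point_space: "convex (point_space I)"
  by (auto intro!: convexI point_spaceI simp: lookup_add lookup_eq_0_outside)

lemma linear_pairing: "linear (pairing I y)"
  by (simp add: linear_iff pairing_def lookup_add algebra_simps sum.distrib sum_distrib_left)

text \<open>For the application of \<open>farkas\<close> the roles are exchanged: the unknown is the
  direction \<open>y\<close>, taken from the free vector space, and points of the polytope act as
  linear forms on it.\<close>

lemma linear_pairing_left: "linear (\<lambda>y. pairing I (Poly_Mapping.lookup y) x)"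
  by (simp add: linear_iff pairing_def lookup_add algebra_simps sum.distrib sum_distrib_left)

lemma pairing_cong: "(\<And>i. i \<in> I \<Longrightarrow> y i = z i) \<Longrightarrow> pairing I y = pairing I z"
  by (auto simp: pairing_def fun_eq_iff)

text \<open>\<open>V\<close> is any finite generating set, not the set of vertices; sums of
  generators can then serve for a product without a discussion of which of them are extreme.\<close>

definition polytope_in :: "'a set \<Rightarrow> ('a \<Rightarrow>\<^sub>0 real) set \<Rightarrow> bool" where
  "polytope_in I P \<longleftrightarrow> (\<exists>V. finite V \<and> V \<noteq> {} \<and> V \<subseteq> point_space I \<and> P = convex hull V)"

lemma polytope_in_subset: "polytope_in I P \<Longrightarrow> P \<subseteq> point_space I"
  using hull_minimal[of _ "point_space I" convex] convex_point_space by (auto simp: polytope_in_def)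

lemma polytope_in_convex: "polytope_in I P \<Longrightarrow> convex P"
  by (auto simp: polytope_in_def)

lemma polytope_in_nonempty: "polytope_in I P \<Longrightarrow> P \<noteq> {}"
  by (auto simp: polytope_in_def)

lemma polytope_in_maximizers_nonempty:
  assumes "polytope_in I P" "linear f"
  shows "maximizers f P \<noteq> {}"
proof -
  obtain V where "finite V" "V \<noteq> {}" "P = convex hull V"
    using assms(1) by (auto simp: polytope_in_def)
  then show ?thesis using maximizers_nonempty[of V f] maximizers_hull[OF assms(2)] by simp
qed

lemma polytope_in_poly_prod:
  assumes "polytope_in S P" "polytope_in T Q"
  shows "polytope_in (S \<union> T) (poly_prod P Q)"
proof -
  obtain V W where V: "finite V" "V \<noteq> {}" "V \<subseteq> point_space S" "P = convex hull V"
    and W: "finite W" "W \<noteq> {}" "W \<subseteq> point_space T" "Q = convex hull W"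
    using assms by (auto simp: polytope_in_def)
  have eq: "poly_prod A B = A + B" for A B :: "('a \<Rightarrow>\<^sub>0 real) set"
    by (auto simp: poly_prod_def set_plus_def)
  have "V + W \<subseteq> point_space (S \<union> T)"
  proof
    fix x assume "x \<in> V + W"
    then obtain v w where "x = v + w" "v \<in> point_space S" "w \<in> point_space T"
      using V(3) W(3) by (auto simp: set_plus_def)
    then show "x \<in> point_space (S \<union> T)"
      by (intro point_spaceI) (simp add: lookup_add lookup_eq_0_outside)
  qed
  moreover have "V + W \<noteq> {}" using V(2) W(2) by (auto simp: set_plus_def)
  ultimately show ?thesis
    using V W by (auto simp: polytope_in_def eq convex_hull_set_plus finite_set_plus
        intro!: exI[of _ "V + W"])
qed

text \<open>Let \<open>x0\<close> be the barycentre of the generators in \<open>F\<close>. For each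
  generator \<open>v\<close> outside \<open>F\<close>, Farkas gives a direction that is maximal over
  \<open>V\<close> at \<open>x0\<close> and strictly smaller at \<open>v\<close>; otherwise
  \<open>x0\<close> would lie in an open segment from \<open>v\<close> into \<open>P\<close>, or
  equal \<open>v\<close>, and the face property would put \<open>v\<close> into \<open>F\<close>.
  The sum of these directions exposes \<open>F\<close>.\<close>

lemma face_of_polytope_exposed:
  assumes "finite I" "polytope_in I P" "F face_of P" "F \<noteq> {}"
  shows "\<exists>y. F = maximizers (pairing I y) P"
proof -
  obtain V where V: "finite V" "V \<subseteq> point_space I" "P = convex hull V"
    using assms(2) by (auto simp: polytope_in_def)
  define W where "W = V \<inter> F"
  have F: "F = convex hull W" using face_of_finite_hull[OF V(1)] assms(3) V(3) by (simp add: W_def)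
  have W: "finite W" "W \<noteq> {}"
  proof -
    show "finite W" using V(1) by (simp add: W_def)
    show "W \<noteq> {}"
    proof
      assume "W = {}"
      then have "F = {}" using F by (metis convex_empty hull_same)
      then show False using assms(4) by simp
    qed
  qed
  \<comment> \<open>Equal positive weights matter: a functional bounded on \<open>W\<close> by its
    value at \<open>x0\<close> averages to that value over \<open>W\<close>, so it is constant on
    \<open>W\<close>.\<close>
  define x0 where "x0 = (\<Sum>w\<in>W. (1 / real (card W)) *\<^sub>R w)"
  have x0F: "x0 \<in> F"
    unfolding x0_def F using W by (intro convex_sum) (auto simp: hull_inc)
  have x0P: "x0 \<in> P" using x0F assms(3) by (auto simp: face_of_def)
  have x0s: "x0 \<in> point_space I" using x0P polytope_in_subset[OF assms(2)] by blast
  have ex: "\<exists>y. (\<forall>w\<in>V. pairing I y (w - x0) \<le> 0) \<and> (v \<notin> F \<longrightarrow> pairing I y (v - x0) < 0)"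
    if v: "v \<in> V" for v
  proof (rule ccontr)
    assume "\<not> ?thesis"
    then have no: "\<And>y. (\<And>w. w \<in> V \<Longrightarrow> pairing I y (w - x0) \<le> 0) \<Longrightarrow> v \<notin> F \<and> \<not> pairing I y (v - x0) < 0"
      by blast
    \<comment> \<open>For \<open>v\<close> in \<open>F\<close> the zero direction satisfies the
      claim, so a failing \<open>v\<close> lies outside \<open>F\<close>.\<close>
    have vF: "v \<notin> F" using no[of "\<lambda>_. 0"] by (simp add: pairing_def)
    have "\<exists>l. (\<forall>w\<in>V. 0 \<le> l w) \<and> (\<forall>y. - pairing I (Poly_Mapping.lookup y) (v - x0) =
        (\<Sum>w\<in>V. l w * pairing I (Poly_Mapping.lookup y) (w - x0)))"
    proof (rule farkas[OF V(1)])
      show "linear (\<lambda>y. - pairing I (Poly_Mapping.lookup y) (v - x0))"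
        using linear_pairing_left by (rule linear_compose_neg)
    qed (use linear_pairing_left no in \<open>auto simp: not_less\<close>)
    then obtain l where l: "\<And>w. w \<in> V \<Longrightarrow> 0 \<le> l w"
      and eq: "\<And>y. - pairing I (Poly_Mapping.lookup y) (v - x0) =
        (\<Sum>w\<in>V. l w * pairing I (Poly_Mapping.lookup y) (w - x0))" by auto
    define L where "L = sum l V"
    have L0: "L \<ge> 0" using l by (auto simp: L_def intro: sum_nonneg)
    have pe: "pairing I (Poly_Mapping.lookup (Poly_Mapping.single i 1)) x = Poly_Mapping.lookup x i"
      if "i \<in> I" for i x
    proof -
      have "pairing I (Poly_Mapping.lookup (Poly_Mapping.single i 1)) x =
        (\<Sum>j\<in>I. if j = i then Poly_Mapping.lookup x i else 0)"
        unfolding pairing_def by (intro sum.cong) (auto simp: lookup_single when_def)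
      then show ?thesis using that assms(1) by simp
    qed
    have ls: "Poly_Mapping.lookup (\<Sum>w\<in>V. l w *\<^sub>R w) i = (\<Sum>w\<in>V. l w * Poly_Mapping.lookup w i)" for i
      by (simp add: lookup_sum)
    \<comment> \<open>Testing the Farkas identity on the basis vectors turns it into
      \<open>x0 - v = (\<Sum>w\<in>V. l w * (w - x0))\<close>, coordinate by coordinate. Collecting
      \<open>x0\<close> on the left and dividing by \<open>1 + L\<close> exhibits \<open>x0\<close>
      as a convex combination of \<open>v\<close> and a point of \<open>P\<close>.\<close>
    have key: "(1 + L) *\<^sub>R x0 = v + (\<Sum>w\<in>V. l w *\<^sub>R w)"
    proof (rule poly_mapping_eqI)
      fix i
      show "Poly_Mapping.lookup ((1 + L) *\<^sub>R x0) i = Poly_Mapping.lookup (v + (\<Sum>w\<in>V. l w *\<^sub>R w)) i"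
      proof (cases "i \<in> I")
        case True
        have "Poly_Mapping.lookup x0 i - Poly_Mapping.lookup v i =
          (\<Sum>w\<in>V. l w * Poly_Mapping.lookup w i) - L * Poly_Mapping.lookup x0 i"
          using eq[of "Poly_Mapping.single i 1"] True
          by (simp add: pe lookup_minus right_diff_distrib sum_subtractf L_def sum_distrib_right)
        then show ?thesis by (simp add: lookup_add ls distrib_right)
      next
        case False
        have "Poly_Mapping.lookup w i = 0" if "w \<in> V" for w
          using lookup_eq_0_outside[of w I i] that V(2) False by auto
        then show ?thesis using False x0s v by (simp add: lookup_add ls lookup_eq_0_outside)
      qed
    qed
    have "v = x0 \<or> (\<exists>z\<in>P. x0 \<in> open_segment v z)"
    proof (cases "L = 0")
      case True
      then have "\<forall>w\<in>V. l w = 0"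
        using l V(1) sum_nonneg_eq_0_iff[of V l] by (simp add: L_def)
      then show ?thesis using key True by simp
    next
      case False
      then have Lp: "L > 0" using L0 by simp
      define z where "z = (\<Sum>w\<in>V. (l w / L) *\<^sub>R w)"
      have z: "z \<in> P"
        unfolding z_def V(3) using V(1) l Lp
        by (intro convex_sum) (auto simp: hull_inc L_def sum_divide_distrib[symmetric])
      have Lz: "(\<Sum>w\<in>V. l w *\<^sub>R w) = L *\<^sub>R z" using Lp by (simp add: z_def scaleR_sum_right)
      define u where "u = L / (1 + L)"
      have u: "0 < u" "u < 1" "1 - u = 1 / (1 + L)" using Lp by (auto simp: u_def field_simps)
      have "x0 = (1 / (1 + L)) *\<^sub>R ((1 + L) *\<^sub>R x0)" using Lp by simp
      also have "\<dots> = (1 / (1 + L)) *\<^sub>R v + u *\<^sub>R z"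
        unfolding key Lz by (simp add: u_def scaleR_right_distrib)
      finally have x0e: "x0 = (1 - u) *\<^sub>R v + u *\<^sub>R z" using u(3) by simp
      show ?thesis
      proof (cases "v = z")
        case True
        then show ?thesis using x0e by simp
      next
        case False
        then have "x0 \<in> open_segment v z" unfolding in_segment using x0e u(1,2) by blast
        then show ?thesis using z by blast
      qed
    qed
    moreover have "v \<in> P" using v V(3) by (simp add: hull_inc)
    ultimately show False using vF x0F assms(3) unfolding face_of_def by metis
  qed
  then obtain Y where Y: "\<And>v w. v \<in> V \<Longrightarrow> w \<in> V \<Longrightarrow> pairing I (Y v) (w - x0) \<le> 0"
    "\<And>v. v \<in> V \<Longrightarrow> v \<notin> F \<Longrightarrow> pairing I (Y v) (v - x0) < 0" by metis
  define y where "y = (\<lambda>i. \<Sum>v\<in>V. Y v i)"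
  have ps: "pairing I y x = (\<Sum>v\<in>V. pairing I (Y v) x)" for x
    unfolding pairing_def y_def by (simp add: sum_distrib_right sum.swap[of _ V I])
  interpret y: linear "pairing I y" by (rule linear_pairing)
  have le: "pairing I y w \<le> pairing I y x0" if "w \<in> V" for w
  proof -
    have "pairing I y (w - x0) \<le> 0" using Y(1) that by (simp add: ps sum_nonpos)
    then show ?thesis by (simp add: y.diff)
  qed
  have lt: "pairing I y w < pairing I y x0" if "w \<in> V" "w \<notin> F" for w
  proof -
    have "pairing I y (w - x0) < (\<Sum>v\<in>V. 0)"
      unfolding ps by (rule sum_strict_mono_ex1) (use Y that V(1) in auto)
    then show ?thesis by (simp add: y.diff)
  qed
  have eqW: "pairing I y w = pairing I y x0" if "w \<in> W" for w
  proof -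
    have "pairing I y x0 = (\<Sum>w\<in>W. pairing I y w) / card W"
      by (simp add: x0_def y.sum y.scale sum_divide_distrib)
    then have "(\<Sum>w\<in>W. pairing I y x0 - pairing I y w) = 0"
      using W by (simp add: sum_subtractf)
    then have "\<forall>w\<in>W. pairing I y x0 - pairing I y w = 0"
      using le W by (subst (asm) sum_nonneg_eq_0_iff) (auto simp: W_def)
    then show ?thesis using that by simp
  qed
  have "maximizers (pairing I y) V = W"
  proof (intro equalityI subsetI)
    fix x assume x: "x \<in> maximizers (pairing I y) V"
    obtain w where "w \<in> W" using W by blast
    then have "pairing I y x0 \<le> pairing I y x" using x eqW by (auto simp: maximizers_def W_def)
    then show "x \<in> W" using x lt by (force simp: maximizers_def W_def)
  next
    fix x assume "x \<in> W"
    then show "x \<in> maximizers (pairing I y) V"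
      using eqW le by (simp add: maximizers_def W_def)
  qed
  then show ?thesis
    using F V(3) maximizers_hull[OF linear_pairing V(1), of I y] by metis
qed

subsection \<open>Normal fans through inclusion of maximizing faces\<close>

lemma normal_cone_maximizers:
  "normal_cone I P (maximizers (pairing I y) P) =
    {z \<in> I \<rightarrow>\<^sub>E UNIV. maximizers (pairing I y) P \<subseteq> maximizers (pairing I z) P}"
  by (auto simp: normal_cone_def maximizers_def)

text \<open>Exposedness replaces faces by directions as indices of the cones. The index
  \<open>y\<close> may be any function, as the pairing reads only its values on \<open>I\<close>,
  whereas the members \<open>z\<close> of a cone are extensional.\<close>

lemma normal_fan_eq_range:
  assumes "finite I" "polytope_in I P"
  shows "normal_fan I P = range (\<lambda>y. {z \<in> I \<rightarrow>\<^sub>E UNIV.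
    maximizers (pairing I y) P \<subseteq> maximizers (pairing I z) P})"
proof (intro equalityI subsetI)
  fix C assume "C \<in> normal_fan I P"
  then obtain F where "C = normal_cone I P F" "F face_of P" "F \<noteq> {}"
    by (auto simp: normal_fan_def)
  then show "C \<in> range (\<lambda>y. {z \<in> I \<rightarrow>\<^sub>E UNIV.
    maximizers (pairing I y) P \<subseteq> maximizers (pairing I z) P})"
    using face_of_polytope_exposed[OF assms, of F] by (auto simp: normal_cone_maximizers)
next
  fix C assume "C \<in> range (\<lambda>y. {z \<in> I \<rightarrow>\<^sub>E UNIV.
    maximizers (pairing I y) P \<subseteq> maximizers (pairing I z) P})"
  then obtain y where "C = normal_cone I P (maximizers (pairing I y) P)"
    by (auto simp: normal_cone_maximizers)
  moreover have "maximizers (pairing I y) P face_of P"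
    using polytope_in_convex[OF assms(2)] by (intro maximizers_face_of linear_pairing)
  moreover have "maximizers (pairing I y) P \<noteq> {}"
    using assms(2) linear_pairing by (rule polytope_in_maximizers_nonempty)
  ultimately show "C \<in> normal_fan I P" by (auto simp: normal_fan_def)
qed

text \<open>The cone of \<open>Q\<close> at \<open>y\<close> is also the cone of \<open>P\<close> at
  some \<open>y'\<close>. It contains \<open>y\<close>, so the face of \<open>P\<close> for
  \<open>y'\<close> lies in that for \<open>y\<close> and hence in that for \<open>z\<close>. Thus
  \<open>z\<close> belongs to the same cone, now read in \<open>Q\<close>. Restriction to
  \<open>I\<close> makes \<open>y\<close> and \<open>z\<close> eligible as members.\<close>

lemma normal_fan_eq_imp:
  assumes "finite I" "polytope_in I P" "polytope_in I Q" "normal_fan I P = normal_fan I Q"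
    and "maximizers (pairing I y) P \<subseteq> maximizers (pairing I z) P"
  shows "maximizers (pairing I y) Q \<subseteq> maximizers (pairing I z) Q"
proof -
  let ?r = "\<lambda>y. restrict y I"
  have r: "pairing I (?r y) = pairing I y" "?r y \<in> I \<rightarrow>\<^sub>E UNIV" for y
    by (auto intro: pairing_cong)
  let ?C = "\<lambda>P y. {z \<in> I \<rightarrow>\<^sub>E UNIV. maximizers (pairing I y) P \<subseteq> maximizers (pairing I z) P}"
  have "?C Q y \<in> normal_fan I P"
    using assms(4) normal_fan_eq_range[OF assms(1,3)] by simp
  then obtain y' where y': "?C Q y = ?C P y'"
    using normal_fan_eq_range[OF assms(1,2)] by auto
  have "?r y \<in> ?C Q y" using r by simp
  then have "maximizers (pairing I y') P \<subseteq> maximizers (pairing I y) P"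
    unfolding y' using r by simp
  then have "?r z \<in> ?C P y'" using assms(5) r by auto
  then show ?thesis unfolding y'[symmetric] using r by simp
qed

lemma normal_fan_eq_iff:
  assumes "finite I" "polytope_in I P" "polytope_in I Q"
  shows "normal_fan I P = normal_fan I Q \<longleftrightarrow>
    (\<forall>y z. maximizers (pairing I y) P \<subseteq> maximizers (pairing I z) P \<longleftrightarrow>
      maximizers (pairing I y) Q \<subseteq> maximizers (pairing I z) Q)"
proof
  assume "normal_fan I P = normal_fan I Q"
  then show "\<forall>y z. maximizers (pairing I y) P \<subseteq> maximizers (pairing I z) P \<longleftrightarrow>
      maximizers (pairing I y) Q \<subseteq> maximizers (pairing I z) Q"
    using normal_fan_eq_imp assms by metis
qed (simp add: normal_fan_eq_range assms)

subsection \<open>Products and the maximal face in direction \<open>1\<^sub>S\<close>\<close>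

text \<open>Disjoint supports make the sum direct, so both summands can be read off from the
  coordinates. An empty factor would empty the product and lose the information about the other
  factor.\<close>

lemma poly_prod_subset_iff:
  assumes "A \<subseteq> point_space S" "A' \<subseteq> point_space S" "B \<subseteq> point_space T" "B' \<subseteq> point_space T"
    and "S \<inter> T = {}" "A \<noteq> {}" "B \<noteq> {}"
  shows "poly_prod A B \<subseteq> poly_prod A' B' \<longleftrightarrow> A \<subseteq> A' \<and> B \<subseteq> B'"
proof
  assume sub: "poly_prod A B \<subseteq> poly_prod A' B'"
  have "a \<in> A' \<and> b \<in> B'" if ab: "a \<in> A" "b \<in> B" for a b
  proof -
    obtain a' b' where a'b': "a + b = a' + b'" "a' \<in> A'" "b' \<in> B'"
      using sub ab by (force simp: poly_prod_def)
    have l: "Poly_Mapping.lookup a i + Poly_Mapping.lookup b i =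
      Poly_Mapping.lookup a' i + Poly_Mapping.lookup b' i" for i
      using a'b'(1) by (metis lookup_add)
    have ps: "a \<in> point_space S" "a' \<in> point_space S" "b \<in> point_space T" "b' \<in> point_space T"
      using ab a'b' assms by auto
    have "a = a'"
    proof (rule point_space_eqI[OF ps(1,2)])
      fix i assume "i \<in> S"
      then have "i \<notin> T" using assms(5) by auto
      then show "Poly_Mapping.lookup a i = Poly_Mapping.lookup a' i"
        using l[of i] ps by (simp add: lookup_eq_0_outside)
    qed
    then show ?thesis using a'b' by auto
  qed
  then show "A \<subseteq> A' \<and> B \<subseteq> B'" using assms(6,7) by blast
qed (auto simp: poly_prod_def)

text \<open>A direction glued from \<open>y\<close> on \<open>S\<close> and \<open>z\<close> on
  \<open>T\<close> acts on each factor through its own piece, so directions for the two factors can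
  be prescribed independently.\<close>

lemma maximizers_poly_prod_pairing:
  assumes "finite S" "finite T" "S \<inter> T = {}" "A \<subseteq> point_space S" "B \<subseteq> point_space T"
  shows "maximizers (pairing (S \<union> T) (\<lambda>i. if i \<in> S then y i else z i)) (poly_prod A B) =
    poly_prod (maximizers (pairing S y) A) (maximizers (pairing T z) B)"
proof -
  let ?f = "pairing (S \<union> T) (\<lambda>i. if i \<in> S then y i else z i)"
  have e: "?f x = (\<Sum>i\<in>S. y i * Poly_Mapping.lookup x i) + (\<Sum>i\<in>T. z i * Poly_Mapping.lookup x i)" for x
  proof -
    have "(\<Sum>i\<in>T. (if i \<in> S then y i else z i) * Poly_Mapping.lookup x i) =
      (\<Sum>i\<in>T. z i * Poly_Mapping.lookup x i)"
      using assms(3) by (intro sum.cong) auto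
    then show ?thesis using assms(1-3) by (simp add: pairing_def sum.union_disjoint)
  qed
  have S: "?f x = pairing S y x" if "x \<in> A" for x
  proof -
    have "(\<Sum>i\<in>T. z i * Poly_Mapping.lookup x i) = 0"
      using assms(3,4) that by (intro sum.neutral) (auto intro: lookup_eq_0_outside)
    then show ?thesis by (simp add: e) (simp add: pairing_def)
  qed
  have T: "?f x = pairing T z x" if "x \<in> B" for x
  proof -
    have "(\<Sum>i\<in>S. y i * Poly_Mapping.lookup x i) = 0"
      using assms(3,5) that by (intro sum.neutral) (auto intro: lookup_eq_0_outside)
    then show ?thesis by (simp add: e) (simp add: pairing_def)
  qed
  have "maximizers ?f (poly_prod A B) = poly_prod (maximizers ?f A) (maximizers ?f B)"
    by (rule maximizers_poly_prod) (rule linear_add[OF linear_pairing])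
  then show ?thesis
    using maximizers_cong[of A ?f "pairing S y"] maximizers_cong[of B ?f "pairing T z"] S T by simp
qed

lemma max_face_eq_maximizers:
  assumes "finite I" "S \<subseteq> I"
  shows "max_face S P = maximizers (pairing I (indicator S)) P"
proof -
  have "pairing I (indicator S) x = (\<Sum>s\<in>S. Poly_Mapping.lookup x s)" for x
  proof -
    have "pairing I (indicator S) x = (\<Sum>i\<in>I. if i \<in> S then Poly_Mapping.lookup x i else 0)"
      unfolding pairing_def by (intro sum.cong) (auto simp: indicator_def)
    also have "\<dots> = (\<Sum>s\<in>S. Poly_Mapping.lookup x s)"
      using assms by (simp add: sum.inter_restrict[symmetric] Int_absorb1)
    finally show ?thesis .
  qed
  then show ?thesis by (simp add: max_face_def maximizers_def)
qed

lemma normal_fan_max_face: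
  assumes "finite I" "S \<subseteq> I" "polytope_in I P" "polytope_in I Q" "normal_fan I P = normal_fan I Q"
  shows "maximizers (pairing I y) (max_face S P) \<subseteq> maximizers (pairing I z) (max_face S P) \<longleftrightarrow>
    maximizers (pairing I y) (max_face S Q) \<subseteq> maximizers (pairing I z) (max_face S Q)"
proof -
  let ?u = "indicator S :: 'a \<Rightarrow> real"
  have pert: "\<forall>\<^sub>F N in at_top. maximizers (pairing I x) (max_face S R) =
    maximizers (pairing I (\<lambda>i. N * ?u i + x i)) R" if R: "polytope_in I R" for x R
  proof -
    have "pairing I (\<lambda>i. N * ?u i + x i) = (\<lambda>p. N * pairing I ?u p + pairing I x p)" for N
      by (simp add: fun_eq_iff pairing_def algebra_simps sum.distrib sum_distrib_left)
    moreover obtain V where "finite V" "R = convex hull V"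
      using R by (auto simp: polytope_in_def)
    ultimately show ?thesis
      using eventually_maximizers_perturb[OF linear_pairing linear_pairing]
      by (simp add: max_face_eq_maximizers[OF assms(1,2)])
  qed
  have "\<forall>\<^sub>F N :: real in at_top. \<forall>x\<in>{y, z}. \<forall>R\<in>{P, Q}.
    maximizers (pairing I x) (max_face S R) = maximizers (pairing I (\<lambda>i. N * ?u i + x i)) R"
    using pert assms(3,4) by (intro eventually_ball_finite ballI) auto
  then obtain N :: real where "\<forall>x\<in>{y, z}. \<forall>R\<in>{P, Q}.
    maximizers (pairing I x) (max_face S R) = maximizers (pairing I (\<lambda>i. N * ?u i + x i)) R"
    using eventually_happens'[OF trivial_limit_at_top_linorder] by blast
  then show ?thesis
    using assms(5) unfolding normal_fan_eq_iff[OF assms(1,3,4)] by simp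
qed

text \<open>With the zero direction on one factor, twice, the inclusion for that factor is trivially
  true. An inclusion between the product faces then tests the other factor alone.\<close>

lemma normal_fan_max_face_components:
  assumes fin: "finite S" "finite T" and disj: "S \<inter> T = {}"
    and P: "polytope_in (S \<union> T) P" and Q: "polytope_in (S \<union> T) Q"
    and fan: "normal_fan (S \<union> T) P = normal_fan (S \<union> T) Q"
    and A: "polytope_in S A" "polytope_in S A'" and B: "polytope_in T B" "polytope_in T B'"
    and prods: "max_face S P = poly_prod A B" "max_face S Q = poly_prod A' B'"
  shows "normal_fan S A = normal_fan S A'" "normal_fan T B = normal_fan T B'"
proof -
  let ?M = "\<lambda>y z A B. poly_prod (maximizers (pairing S y) A) (maximizers (pairing T z) B)"
  have iff: "?M y z A B \<subseteq> ?M y' z' A B \<longleftrightarrow> ?M y z A' B' \<subseteq> ?M y' z' A' B'" for y z y' z'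
    using normal_fan_max_face[OF _ _ P Q fan, of S "\<lambda>i. if i \<in> S then y i else z i"
        "\<lambda>i. if i \<in> S then y' i else z' i"] fin
    by (simp add: prods maximizers_poly_prod_pairing fin disj polytope_in_subset A B)
  have sub: "?M y z C D \<subseteq> ?M y' z' C D \<longleftrightarrow>
      maximizers (pairing S y) C \<subseteq> maximizers (pairing S y') C \<and>
      maximizers (pairing T z) D \<subseteq> maximizers (pairing T z') D"
    if "polytope_in S C" "polytope_in T D" for y z y' z' C D
    using subset_trans[OF maximizers_subset polytope_in_subset[OF that(1)]]
      subset_trans[OF maximizers_subset polytope_in_subset[OF that(2)]]
      polytope_in_maximizers_nonempty[OF that(1) linear_pairing]
      polytope_in_maximizers_nonempty[OF that(2) linear_pairing]
    by (intro poly_prod_subset_iff[of _ S _ _ T]) (simp_all add: disj)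
  have "maximizers (pairing S y) A \<subseteq> maximizers (pairing S y') A \<longleftrightarrow>
      maximizers (pairing S y) A' \<subseteq> maximizers (pairing S y') A'" for y y'
    using iff[of y "\<lambda>_. 0" y' "\<lambda>_. 0"] sub A B by simp
  then show "normal_fan S A = normal_fan S A'"
    using normal_fan_eq_iff[OF fin(1) A] by simp
  have "maximizers (pairing T y) B \<subseteq> maximizers (pairing T y') B \<longleftrightarrow>
      maximizers (pairing T y) B' \<subseteq> maximizers (pairing T y') B'" for y y'
    using iff[of "\<lambda>_. 0" y "\<lambda>_. 0" y'] sub A B by simp
  then show "normal_fan T B = normal_fan T B'"
    using normal_fan_eq_iff[OF fin(2) B] by simp
qed

subsection \<open>Compositions of multisets of values\<close>

text \<open>This is \<open>point_composition\<close> with the point replaced by its multiset of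
  coordinates, so that the compositions over \<open>S\<close>, \<open>T\<close> and \<open>I\<close>
  are related through \<open>A\<close>, \<open>B\<close> and \<open>A + B\<close>.\<close>

definition mset_composition :: "'b::linorder multiset \<Rightarrow> nat list" where
  "mset_composition M = map (count M) (rev (sorted_list_of_set (set_mset M)))"

lemma sorted_list_of_set_Un_less:
  fixes X Y :: "'b::linorder set"
  assumes "finite X" "finite Y" "\<And>x y. x \<in> X \<Longrightarrow> y \<in> Y \<Longrightarrow> x < y"
  shows "sorted_list_of_set (X \<union> Y) = sorted_list_of_set X @ sorted_list_of_set Y"
proof (rule sorted_distinct_set_unique)
  show "distinct (sorted_list_of_set X @ sorted_list_of_set Y)"
    using assms by (auto dest: assms(3))
  show "sorted (sorted_list_of_set X @ sorted_list_of_set Y)"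
    using assms by (auto simp: sorted_append intro: less_imp_le)
qed (use assms(1,2) in auto)

lemma is_composition_mset_composition: "is_composition (size M) (mset_composition M)"
proof -
  have "sum_list (mset_composition M) = (\<Sum>x\<in>set_mset M. count M x)"
    by (simp add: mset_composition_def sum_list_distinct_conv_sum_set rev_map[symmetric])
  then show ?thesis
    by (auto simp: is_composition_def mset_composition_def size_multiset_overloaded_eq)
qed

lemma mset_composition_union_less:
  fixes A B :: "'b::linorder multiset"
  assumes "\<And>a b. a \<in># A \<Longrightarrow> b \<in># B \<Longrightarrow> b < a"
  shows "mset_composition (A + B) = mset_composition A @ mset_composition B"
proof -
  have "count B a = 0" if "a \<in># A" for a
    using assms[OF that, of a] by (auto simp: count_eq_zero_iff)
  moreover have "count A b = 0" if "b \<in># B" for b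
    using assms[OF _ that, of b] by (auto simp: count_eq_zero_iff)
  moreover have "sorted_list_of_set (set_mset A \<union> set_mset B) =
    sorted_list_of_set (set_mset B) @ sorted_list_of_set (set_mset A)"
    using sorted_list_of_set_Un_less[of "set_mset B" "set_mset A"] assms by (simp add: Un_commute)
  ultimately show ?thesis by (simp add: mset_composition_def)
qed

text \<open>A value \<open>m\<close> common to \<open>A\<close> and \<open>B\<close> is the least
  value of \<open>A\<close> and the greatest of \<open>B\<close>, hence the only common one. Its two
  multiplicities, last part of one composition and first part of the other, add up in
  \<open>A + B\<close>: this is near-concatenation. Without a common value the parts are merely
  listed one after the other.\<close>

lemma splits_mset_composition:
  fixes A B :: "'b::linorder multiset"
  assumes le: "\<And>a b. a \<in># A \<Longrightarrow> b \<in># B \<Longrightarrow> b \<le> a"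
  shows "splits_composition (mset_composition (A + B)) (size A) (size B)
    (mset_composition A) (mset_composition B)"
proof (cases "\<exists>m. m \<in># A \<and> m \<in># B")
  case False
  then have "b < a" if "a \<in># A" "b \<in># B" for a b
    using le[OF that] that by (metis order_le_imp_less_or_eq)
  then show ?thesis
    by (simp add: splits_composition_def is_composition_mset_composition mset_composition_union_less)
next
  case True
  then obtain m where m: "m \<in># A" "m \<in># B" by blast
  define A' B' where "A' = set_mset A - {m}" and "B' = set_mset B - {m}"
  have A': "finite A'" "m < a" "count B a = 0" if "a \<in> A'" for a
  proof -
    show "m < a" using le[OF _ m(2), of a] that by (auto simp: A'_def)
    then show "count B a = 0" using le[OF m(1), of a] by (force simp: count_eq_zero_iff)
  qed (simp add: A'_def)
  have B': "b < m" "count A b = 0" if "b \<in> B'" for b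
  proof -
    show "b < m" using le[OF m(1), of b] that by (auto simp: B'_def)
    then show "count A b = 0" using le[OF _ m(2), of b] by (force simp: count_eq_zero_iff)
  qed
  have fin: "finite A'" "finite B'" by (simp_all add: A'_def B'_def)
  have sA: "set_mset A = {m} \<union> A'" and sB: "set_mset B = B' \<union> {m}"
    and sAB: "set_mset (A + B) = (B' \<union> {m}) \<union> A'"
    using m by (auto simp: A'_def B'_def)
  have slA: "sorted_list_of_set (set_mset A) = m # sorted_list_of_set A'"
    unfolding sA using A' fin by (subst sorted_list_of_set_Un_less) auto
  have slB: "sorted_list_of_set (set_mset B) = sorted_list_of_set B' @ [m]"
    unfolding sB using B' fin by (subst sorted_list_of_set_Un_less) auto
  have slAB: "sorted_list_of_set (set_mset (A + B)) =
    sorted_list_of_set B' @ m # sorted_list_of_set A'"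
  proof -
    have "x < a" if "x \<in> B' \<union> {m}" "a \<in> A'" for x a
      using A'(2)[OF that(2)] B'(1)[of x] that(1) by auto
    then have "sorted_list_of_set ((B' \<union> {m}) \<union> A') =
      sorted_list_of_set (B' \<union> {m}) @ sorted_list_of_set A'"
      using fin by (intro sorted_list_of_set_Un_less) auto
    then show ?thesis using slB unfolding sAB sB by simp
  qed
  have "near_concat (mset_composition A) (mset_composition B) = mset_composition (A + B)"
    unfolding mset_composition_def slA slB slAB near_concat_def
    using A'(3) B'(2) fin by simp
  moreover have "mset_composition A \<noteq> []" "mset_composition B \<noteq> []"
    by (simp_all add: mset_composition_def slA slB)
  ultimately show ?thesis
    by (simp add: splits_composition_def is_composition_mset_composition)
qed

lemma ex_mset_composition:
  assumes "is_composition n \<alpha>"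
  shows "\<exists>M :: real multiset. size M = n \<and> mset_composition M = \<alpha>"
  using assms
proof (induction \<alpha> arbitrary: n)
  case Nil
  then show ?case by (auto simp: is_composition_def mset_composition_def)
next
  case (Cons a \<alpha>)
  then have a: "a > 0" and n: "n = a + sum_list \<alpha>" and c: "is_composition (sum_list \<alpha>) \<alpha>"
    by (auto simp: is_composition_def)
  obtain N :: "real multiset" where N: "size N = sum_list \<alpha>" "mset_composition N = \<alpha>"
    using Cons.IH[OF c] by blast
  \<comment> \<open>The new largest value, to be taken \<open>a\<close> times; the inserted 0 keeps
    \<open>Max\<close> meaningful when \<open>N\<close> is empty.\<close>
  define b where "b = Max (insert 0 (set_mset N)) + 1"
  have b: "x < b" if "x \<in># N" for x
  proof -
    have "x \<le> Max (insert 0 (set_mset N))" using that by (intro Max_ge) auto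
    then show ?thesis by (simp add: b_def)
  qed
  have "mset_composition (replicate_mset a b + N) = mset_composition (replicate_mset a b) @ \<alpha>"
    using b N by (subst mset_composition_union_less) (auto split: if_splits)
  also have "mset_composition (replicate_mset a b) = [a]"
    using a by (simp add: mset_composition_def)
  finally show ?case using N n by (intro exI[of _ "replicate_mset a b + N"]) simp
qed

text \<open>Equal compositions say that the values in the same position of the two sorted lists have
  equal multiplicity; \<open>f\<close> sends the value at position \<open>i\<close> in one list to
  that at position \<open>i\<close> in the other.\<close>

lemma mset_composition_eq_imp:
  fixes M :: "'b::linorder multiset" and N :: "'c::linorder multiset"
  assumes "mset_composition M = mset_composition N"
  shows "\<exists>f. strict_mono_on (set_mset M) f \<and> N = image_mset f M"
proof -
  define xs ys where "xs = sorted_list_of_set (set_mset M)" and "ys = sorted_list_of_set (set_mset N)"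
  have c: "map (count M) xs = map (count N) ys"
    using assms by (simp add: mset_composition_def xs_def ys_def rev_map[symmetric])
  then have len: "length xs = length ys" by (metis length_map)
  have xs: "set xs = set_mset M" "distinct xs" "sorted_wrt (<) xs"
    and ys: "set ys = set_mset N" "distinct ys" "sorted_wrt (<) ys"
    by (simp_all add: xs_def ys_def)
  define f where "f x = the (map_of (zip xs ys) x)" for x
  have f: "f (xs ! i) = ys ! i" if "i < length xs" for i
    using that len xs(2) by (simp add: f_def map_of_zip_nth)
  have mono: "strict_mono_on (set_mset M) f"
  proof (rule strict_mono_onI)
    fix r s assume "r \<in># M" "s \<in># M" and rs: "r < s"
    then obtain i j where ij: "i < length xs" "j < length xs" "r = xs ! i" "s = xs ! j"
      using xs(1) by (metis in_set_conv_nth)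
    have "i < j"
      using sorted_wrt_nth_less[OF xs(3), of j i] rs ij by (metis less_asym linorder_neqE_nat less_irrefl)
    then show "f r < f s"
      using sorted_wrt_nth_less[OF ys(3), of i j] ij len f by simp
  qed
  have "N = image_mset f M"
  proof (rule multiset_eqI)
    fix y
    show "count N y = count (image_mset f M) y"
    proof (cases "y \<in># N")
      case True
      then obtain j where j: "j < length ys" "y = ys ! j"
        using ys(1) by (metis in_set_conv_nth)
      have "{x. x \<in># M \<and> y = f x} = {xs ! j}"
      proof -
        have mem: "xs ! j \<in># M" using j len xs(1) by (metis nth_mem)
        have "x = xs ! j" if "x \<in># M" "y = f x" for x
          using strict_mono_on_imp_inj_on[OF mono] mem that j f len by (metis inj_onD)
        moreover have "y = f (xs ! j)" using j f len by simp
        ultimately show ?thesis using mem by blast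
      qed
      then have "count (image_mset f M) y = count M (xs ! j)" by (simp add: count_image_mset')
      also have "\<dots> = count N y" using c j len by (metis nth_map)
      finally show ?thesis by simp
    next
      case False
      have "y \<notin># image_mset f M"
      proof
        assume "y \<in># image_mset f M"
        then obtain x where "x \<in># M" "y = f x" by auto
        then obtain i where "i < length xs" "y = ys ! i"
          using xs(1) f by (metis in_set_conv_nth)
        then show False using False len ys(1) by (metis nth_mem)
      qed
      then show ?thesis using False by (metis not_in_iff)
    qed
  qed
  then show ?thesis using mono by blast
qed

text \<open>The sorted list of \<open>A + B\<close> is that of \<open>B\<close> followed by that of
  \<open>A\<close>, so the total and the size of \<open>A\<close> determine \<open>A\<close> as a
  final segment.\<close>

lemma mset_split_unique:
  fixes A B A' B' :: "'b::linorder multiset"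
  assumes "A + B = A' + B'" "size A = size A'"
    and "\<And>a b. a \<in># A \<Longrightarrow> b \<in># B \<Longrightarrow> b \<le> a"
    and "\<And>a b. a \<in># A' \<Longrightarrow> b \<in># B' \<Longrightarrow> b \<le> a"
  shows "A = A'"
proof -
  have app: "sorted_list_of_multiset (C + D) = sorted_list_of_multiset D @ sorted_list_of_multiset C"
    if "\<And>a b. a \<in># C \<Longrightarrow> b \<in># D \<Longrightarrow> b \<le> a" for C D :: "'b multiset"
  proof -
    have "sorted (sorted_list_of_multiset D @ sorted_list_of_multiset C)"
      using that by (simp add: sorted_append)
    then have "sort (sorted_list_of_multiset D @ sorted_list_of_multiset C) =
        sorted_list_of_multiset D @ sorted_list_of_multiset C"
      by (rule sorted_sort_id)
    then show ?thesis
      by (metis mset_append mset_sorted_list_of_multiset sorted_list_of_multiset_mset union_commute)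
  qed
  have "length (sorted_list_of_multiset A) = length (sorted_list_of_multiset A')"
    using assms(2) by (metis mset_sorted_list_of_multiset size_mset)
  then have "sorted_list_of_multiset A = sorted_list_of_multiset A'"
    using app[of A B] app[of A' B'] assms by (metis append_eq_append_conv)
  then show ?thesis by (metis mset_sorted_list_of_multiset)
qed

subsection \<open>Uniqueness of the split\<close>

lemma is_composition_0_iff: "is_composition 0 \<beta> \<longleftrightarrow> \<beta> = []"
  by (cases \<beta>) (auto simp: is_composition_def)

text \<open>The alternatives are separated by the position of \<open>s\<close> relative to 0 and
  \<open>a\<close>. They exclude each other, so two splits of the same composition fall under the
  same one, which drives the induction for uniqueness.\<close>

lemma splits_composition_Cons:
  assumes "splits_composition (a # \<alpha>) s t \<beta> \<gamma>"
  shows "(s = 0 \<and> \<beta> = [] \<and> \<gamma> = a # \<alpha>) \<or>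
    (0 < s \<and> s < a \<and> \<beta> = [s] \<and> \<gamma> = (a - s) # \<alpha>) \<or>
    (0 < s \<and> s = a \<and> \<beta> = [a] \<and> \<gamma> = \<alpha>) \<or>
    (a < s \<and> (\<exists>\<beta>'. \<beta> = a # \<beta>' \<and> splits_composition \<alpha> (s - a) t \<beta>' \<gamma>))"
proof (cases \<beta>)
  case Nil
  then show ?thesis using assms by (auto simp: splits_composition_def is_composition_def near_concat_def)
next
  case (Cons b \<beta>')
  then have b: "0 < b" "s = b + sum_list \<beta>'" and c: "is_composition (s - b) \<beta>'"
    using assms by (auto simp: splits_composition_def is_composition_def)
  show ?thesis
  proof (cases "\<beta>' = []")
    case True
    show ?thesis
    proof (cases "\<beta> @ \<gamma> = a # \<alpha>")
      case True
      then show ?thesis using Cons \<open>\<beta>' = []\<close> b by auto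
    next
      case False
      then have "\<gamma> \<noteq> []" "near_concat \<beta> \<gamma> = a # \<alpha>" "is_composition t \<gamma>"
        using assms by (auto simp: splits_composition_def)
      then show ?thesis using Cons \<open>\<beta>' = []\<close> b
        by (cases \<gamma>) (auto simp: near_concat_def is_composition_def)
    qed
  next
    case False
    \<comment> \<open>A nonempty rest has positive sum, hence \<open>b < s\<close>. Both ways of
      joining leave the first part \<open>b\<close> intact, so \<open>b = a\<close> and the
      recursive alternative holds.\<close>
    then have "sum_list \<beta>' > 0" using c b by (metis is_composition_0_iff is_composition_def
          add_diff_cancel_left' gr0I)
    then show ?thesis
      using assms Cons False b c by (auto simp: splits_composition_def near_concat_def)
  qed
qed

lemma splits_composition_unique:
  assumes "splits_composition \<alpha> s t \<beta> \<gamma>" "splits_composition \<alpha> s t \<beta>' \<gamma>'"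
  shows "\<beta> = \<beta>' \<and> \<gamma> = \<gamma>'"
  using assms
proof (induction \<alpha> arbitrary: s \<beta> \<beta>')
  case Nil
  then show ?case by (auto simp: splits_composition_def near_concat_def)
next
  case (Cons a \<alpha>)
  show ?case
    using splits_composition_Cons[OF Cons.prems(1)] splits_composition_Cons[OF Cons.prems(2)]
      Cons.IH by auto
qed

subsection \<open>Orbits\<close>

definition coord_mset :: "'a set \<Rightarrow> ('a \<Rightarrow>\<^sub>0 real) \<Rightarrow> real multiset" where
  "coord_mset I p = image_mset (Poly_Mapping.lookup p) (mset_set I)"

text \<open>The orbit under permutations in a permutation-free form, identified by
  \<open>perm_orbit_eq\<close>; splitting it along \<open>S\<close> and \<open>T\<close> then
  requires only multiset arithmetic.\<close>

definition orbit :: "'a set \<Rightarrow> ('a \<Rightarrow>\<^sub>0 real) \<Rightarrow> ('a \<Rightarrow>\<^sub>0 real) set" where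
  "orbit I p = {q \<in> point_space I. coord_mset I q = coord_mset I p}"

text \<open>With \<open>g\<close> the coordinates of a point \<open>p\<close>, this is the
  projection of \<open>p\<close> to the coordinates in \<open>I\<close>; it supplies the two factors
  of a maximal face.\<close>

definition point :: "'a set \<Rightarrow> ('a \<Rightarrow> real) \<Rightarrow> ('a \<Rightarrow>\<^sub>0 real)" where
  "point I g = Abs_poly_mapping (\<lambda>i. if i \<in> I then g i else 0)"

lemma lookup_point: "finite I \<Longrightarrow> Poly_Mapping.lookup (point I g) i = (if i \<in> I then g i else 0)"
  unfolding point_def by (subst lookup_Abs_poly_mapping) (auto intro: finite_subset[of _ I])

lemma point_in_point_space: "finite I \<Longrightarrow> point I g \<in> point_space I"
  by (intro point_spaceI) (simp add: lookup_point)

lemma coord_mset_point: "finite I \<Longrightarrow> coord_mset I (point I g) = image_mset g (mset_set I)"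
  unfolding coord_mset_def by (intro image_mset_cong) (simp add: lookup_point)

lemma size_coord_mset: "size (coord_mset I p) = card I"
  by (simp add: coord_mset_def)

lemma set_coord_mset: "finite I \<Longrightarrow> set_mset (coord_mset I p) = Poly_Mapping.lookup p ` I"
  by (simp add: coord_mset_def)

lemma coord_mset_Un:
  assumes "finite S" "finite T" "S \<inter> T = {}"
  shows "coord_mset (S \<union> T) p = coord_mset S p + coord_mset T p"
  using assms by (simp add: coord_mset_def mset_set_Union)

lemma point_composition_eq:
  assumes "finite I"
  shows "point_composition I p = mset_composition (coord_mset I p)"
proof -
  have "count (coord_mset I p) v = card {i \<in> I. Poly_Mapping.lookup p i = v}" for v
    using assms by (simp add: coord_mset_def count_image_mset' eq_commute[of v] sum.If_cases)
  then show ?thesis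
    using assms by (simp add: point_composition_def mset_composition_def set_coord_mset)
qed

lemma orbit_self: "p \<in> point_space I \<Longrightarrow> p \<in> orbit I p"
  by (simp add: orbit_def)

lemma orbit_eq: "q \<in> orbit I p \<Longrightarrow> orbit I q = orbit I p"
  by (simp add: orbit_def)

lemma permute_coords_in_orbit:
  assumes "finite I" "\<tau> permutes I"
  shows "point I (Poly_Mapping.lookup p \<circ> \<tau>) \<in> orbit I p"
proof -
  have "image_mset (Poly_Mapping.lookup p \<circ> \<tau>) (mset_set I) =
    image_mset (Poly_Mapping.lookup p) (image_mset \<tau> (mset_set I))"
    by (simp add: multiset.map_comp)
  also have "image_mset \<tau> (mset_set I) = mset_set I"
    using assms(2) by (simp add: image_mset_mset_set permutes_inj_on permutes_image)
  finally show ?thesis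
    unfolding orbit_def by (simp only: mem_Collect_eq point_in_point_space[OF assms(1)]
        coord_mset_point[OF assms(1)]) (simp add: coord_mset_def)
qed

lemma lookup_perm_act:
  assumes "\<sigma> permutes I"
  shows "Poly_Mapping.lookup (perm_act \<sigma> p) i = Poly_Mapping.lookup p (inv \<sigma> i)"
  using permutes_inj[OF permutes_inv[OF assms]] by (simp add: perm_act_def map_key.rep_eq)

lemma perm_act_eq_point:
  assumes "finite I" "p \<in> point_space I" "\<sigma> permutes I"
  shows "perm_act \<sigma> p = point I (Poly_Mapping.lookup p \<circ> inv \<sigma>)"
proof (rule poly_mapping_eqI)
  fix i
  have "Poly_Mapping.lookup p (inv \<sigma> i) = 0" if "i \<notin> I"
    using permutes_not_in[OF permutes_inv[OF assms(3)] that] lookup_eq_0_outside[OF assms(2) that] by simp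
  then show "Poly_Mapping.lookup (perm_act \<sigma> p) i =
      Poly_Mapping.lookup (point I (Poly_Mapping.lookup p \<circ> inv \<sigma>)) i"
    by (simp add: lookup_perm_act[OF assms(3)] lookup_point[OF assms(1)])
qed

lemma perm_orbit_eq:
  assumes "finite I" "p \<in> point_space I"
  shows "{perm_act \<sigma> p | \<sigma>. \<sigma> permutes I} = orbit I p"
proof (intro equalityI subsetI)
  fix q assume "q \<in> {perm_act \<sigma> p | \<sigma>. \<sigma> permutes I}"
  then show "q \<in> orbit I p"
    using permute_coords_in_orbit[OF assms(1) permutes_inv] perm_act_eq_point[OF assms] by auto
next
  fix q assume q: "q \<in> orbit I p"
  then have "image_mset (Poly_Mapping.lookup q) (mset_set I) = image_mset (Poly_Mapping.lookup p) (mset_set I)"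
    by (simp add: orbit_def coord_mset_def)
  then obtain \<tau> where \<tau>: "\<tau> permutes I" "\<forall>i\<in>I. Poly_Mapping.lookup q i = Poly_Mapping.lookup p (\<tau> i)"
    using image_mset_eq_implies_permutes[OF assms(1)] by blast
  \<comment> \<open>The inverse appears because the action precomposes coordinates with the inverse
    permutation, while \<open>\<tau>\<close> was obtained by direct precomposition.\<close>
  have "perm_act (inv \<tau>) p = q"
    using \<tau> q assms by (intro point_space_eqI[of _ I])
      (auto simp: perm_act_eq_point[OF assms permutes_inv] permutes_inv_inv point_in_point_space
        lookup_point orbit_def)
  then show "q \<in> {perm_act \<sigma> p | \<sigma>. \<sigma> permutes I}"
    using permutes_inv[OF \<tau>(1)] by blast
qed

lemma orbit_polytope_eq_hull:
  "finite I \<Longrightarrow> p \<in> point_space I \<Longrightarrow> orbit_polytope I p = convex hull (orbit I p)"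
  by (simp add: orbit_polytope_def perm_orbit_eq)

lemma finite_orbit:
  assumes "finite I" "p \<in> point_space I"
  shows "finite (orbit I p)"
  unfolding perm_orbit_eq[OF assms, symmetric] using finite_permutations[OF assms(1)] by simp

lemma polytope_in_orbit_polytope:
  assumes "finite I" "p \<in> point_space I"
  shows "polytope_in I (orbit_polytope I p)"
  unfolding polytope_in_def orbit_polytope_eq_hull[OF assms]
proof (intro exI conjI)
  show "orbit I p \<noteq> {}" using orbit_self[OF assms(2)] by blast
  show "orbit I p \<subseteq> point_space I" by (auto simp: orbit_def)
qed (rule finite_orbit[OF assms], rule refl)

subsection \<open>Rearrangement\<close>

text \<open>Only strict inequalities of \<open>y\<close> constrain \<open>q\<close>; on ties of
  \<open>y\<close> the coordinates of \<open>q\<close> are free. For an indicator function this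
  freedom permits arbitrary rearrangement inside \<open>S\<close> and inside
  \<open>T\<close>.\<close>

definition concordant :: "'a set \<Rightarrow> ('a \<Rightarrow> real) \<Rightarrow> ('a \<Rightarrow>\<^sub>0 real) \<Rightarrow> bool" where
  "concordant I y q \<longleftrightarrow>
    (\<forall>i\<in>I. \<forall>j\<in>I. y j < y i \<longrightarrow> Poly_Mapping.lookup q j \<le> Poly_Mapping.lookup q i)"

text \<open>Choose \<open>i\<close> with \<open>y i\<close> maximal and, among such indices,
  \<open>v i\<close> maximal; then \<open>v i\<close> is the greatest value of \<open>v\<close>, and
  some \<open>w k\<close> equals it. Exchanging \<open>w i\<close> and \<open>w k\<close> does not
  decrease the sum, the gain being \<open>(y i - y k) * (v i - w i)\<close>, and afterwards
  \<open>i\<close> can be removed.\<close>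

lemma rearrangement:
  fixes y v w :: "'a \<Rightarrow> real"
  assumes "finite I" "image_mset w (mset_set I) = image_mset v (mset_set I)"
    and "\<And>i j. i \<in> I \<Longrightarrow> j \<in> I \<Longrightarrow> y j < y i \<Longrightarrow> v j \<le> v i"
  shows "(\<Sum>i\<in>I. y i * w i) \<le> (\<Sum>i\<in>I. y i * v i)"
  using assms
proof (induction "card I" arbitrary: I w)
  case 0
  then show ?case by simp
next
  case (Suc n)
  note fin = Suc.prems(1) and ms = Suc.prems(2) and conc = Suc.prems(3)
  have ne: "I \<noteq> {}" using Suc.hyps(2) by auto
  define J where "J = {j \<in> I. y j = Max (y ` I)}"
  have "Max (y ` I) \<in> y ` I" using fin ne by (intro Max_in) auto
  then have "J \<noteq> {}" by (auto simp: J_def)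
  then have "Max (v ` J) \<in> v ` J" using fin by (intro Max_in) (auto simp: J_def)
  then obtain i where i: "i \<in> J" "v i = Max (v ` J)" by auto
  have yi: "y j \<le> y i" if "j \<in> I" for j
    using i(1) fin that by (simp add: J_def)
  have iI: "i \<in> I" using i(1) by (simp add: J_def)
  have vi: "v j \<le> v i" if j: "j \<in> I" for j
  proof (cases "y j < y i")
    case True
    then show ?thesis using conc iI j by blast
  next
    case False
    then have "j \<in> J" using yi[OF j] i(1) j by (simp add: J_def)
    then show ?thesis using i(2) fin by (simp add: J_def)
  qed
  have vals: "w ` I = v ` I"
    using arg_cong[OF ms, of set_mset] fin by simp
  have wi: "w j \<le> v i" if "j \<in> I" for j
  proof -
    have "w j \<in> v ` I" using that vals by blast
    then show ?thesis using vi by auto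
  qed
  obtain k where k: "k \<in> I" "w k = v i" using vals iI by (metis imageE imageI)
  define K where "K = I - {i}"
  have K: "finite K" "i \<notin> K" "I = insert i K" using fin iI by (auto simp: K_def)
  \<comment> \<open>The exchange as seen on \<open>K\<close>: position \<open>k\<close> receives the
    old \<open>w i\<close>, while the value \<open>v i\<close> arriving at \<open>i\<close> is
    accounted for separately. If \<open>k = i\<close>, nothing changes.\<close>
  define w' where "w' = w(k := w i)"
  have "image_mset w' (mset_set K) = image_mset v (mset_set K)
    \<and> y i * w i + (\<Sum>j\<in>K. y j * w j) \<le> y i * v i + (\<Sum>j\<in>K. y j * w' j)"
  proof (cases "k = i")
    case True
    have "\<And>j. j \<in> K \<Longrightarrow> w' j = w j" using True K by (auto simp: w'_def)
    then have "image_mset w' (mset_set K) = image_mset w (mset_set K)"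
      "(\<Sum>j\<in>K. y j * w' j) = (\<Sum>j\<in>K. y j * w j)"
      using K by (auto intro!: image_mset_cong sum.cong)
    then show ?thesis using ms K k True by simp
  next
    case False
    define L where "L = K - {k}"
    have L: "finite L" "k \<notin> L" "K = insert k L" using K k False by (auto simp: L_def)
    have eq: "\<And>j. j \<in> L \<Longrightarrow> w' j = w j" "w' k = w i" using L by (auto simp: w'_def)
    have "image_mset w' (mset_set L) = image_mset w (mset_set L)"
      "(\<Sum>j\<in>L. y j * w' j) = (\<Sum>j\<in>L. y j * w j)"
      using eq L by (auto intro!: image_mset_cong sum.cong)
    moreover have "0 \<le> (y i - y k) * (v i - w i)"
      using yi[OF k(1)] wi[OF iI] by simp
    ultimately show ?thesis
      using ms K L k eq(2) by (auto simp: algebra_simps)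
  qed
  moreover have "(\<Sum>j\<in>K. y j * w' j) \<le> (\<Sum>j\<in>K. y j * v j)"
    using Suc.hyps(1)[of K w'] Suc.hyps(2) K calculation conc by auto
  ultimately show ?case using K by simp
qed

text \<open>Exchanging the coordinates \<open>i\<close> and \<open>j\<close> of \<open>q\<close>
  lowers the pairing by the product of the differences of \<open>y\<close> and of \<open>q\<close>,
  so a maximizer has no pair in the wrong order. The converse is the rearrangement
  inequality.\<close>

lemma maximizers_orbit:
  assumes "finite I"
  shows "maximizers (pairing I y) (orbit I p) = {q \<in> orbit I p. concordant I y q}"
proof (intro equalityI subsetI)
  fix q assume q: "q \<in> maximizers (pairing I y) (orbit I p)"
  then have qo: "q \<in> orbit I p" by (simp add: maximizers_def)
  have "Poly_Mapping.lookup q j \<le> Poly_Mapping.lookup q i"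
    if ij: "i \<in> I" "j \<in> I" "y j < y i" for i j
  proof -
    let ?l = "Poly_Mapping.lookup q"
    define q' where "q' = point I (?l \<circ> Transposition.transpose i j)"
    have "q' \<in> orbit I p"
      using permute_coords_in_orbit[OF assms permutes_swap_id[OF ij(1,2)], of q] orbit_eq[OF qo]
      by (simp add: q'_def)
    then have le: "pairing I y q' \<le> pairing I y q" using q by (simp add: maximizers_def)
    have ne: "i \<noteq> j" using ij by auto
    define K where "K = I - {i} - {j}"
    have K: "I = insert i (insert j K)" "finite K" "i \<notin> K" "j \<notin> K" using ij assms by (auto simp: K_def)
    have "Poly_Mapping.lookup q' i = ?l j" "Poly_Mapping.lookup q' j = ?l i"
      using ij assms by (simp_all add: q'_def lookup_point)
    moreover have "Poly_Mapping.lookup q' k = ?l k" if "k \<in> K" for k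
      using that K assms by (auto simp: q'_def lookup_point Transposition.transpose_def)
    then have "(\<Sum>k\<in>K. y k * Poly_Mapping.lookup q' k) = (\<Sum>k\<in>K. y k * ?l k)"
      by (intro sum.cong) auto
    ultimately have "y i * ?l j + y j * ?l i \<le> y i * ?l i + y j * ?l j"
      using le ne K(2-4) unfolding pairing_def K(1) by simp
    then have "0 \<le> (y i - y j) * (?l i - ?l j)" by (simp add: algebra_simps)
    then show ?thesis using ij(3) by (simp add: zero_le_mult_iff)
  qed
  then show "q \<in> {q \<in> orbit I p. concordant I y q}"
    using qo by (simp add: concordant_def)
next
  fix q assume "q \<in> {q \<in> orbit I p. concordant I y q}"
  then have qo: "q \<in> orbit I p" and c: "concordant I y q" by auto
  have "pairing I y r \<le> pairing I y q" if "r \<in> orbit I p" for r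
    unfolding pairing_def
  proof (rule rearrangement[OF assms])
    show "image_mset (Poly_Mapping.lookup r) (mset_set I) = image_mset (Poly_Mapping.lookup q) (mset_set I)"
      using that qo by (simp add: orbit_def coord_mset_def)
  qed (use c in \<open>auto simp: concordant_def\<close>)
  then show "q \<in> maximizers (pairing I y) (orbit I p)" using qo by (simp add: maximizers_def)
qed

section \<open>Normal fans and vertices of orbit polytopes\<close>

lemma orbit_polytope_maximizers_subset_iff:
  assumes "finite I" "p \<in> point_space I"
  shows "maximizers (pairing I y) (orbit_polytope I p) \<subseteq> maximizers (pairing I z) (orbit_polytope I p)
    \<longleftrightarrow> (\<forall>q\<in>orbit I p. concordant I y q \<longrightarrow> concordant I z q)"
  unfolding orbit_polytope_eq_hull[OF assms]
    maximizers_hull_subset_iff[OF linear_pairing linear_pairing finite_orbit[OF assms]]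
    maximizers_orbit[OF assms(1)]
  by auto

text \<open>The strictly increasing relabelling of values between equal compositions carries
  \<open>q'\<close> into the orbit of \<open>p\<close>. It preserves and reflects every comparison
  of coordinates, hence concordance with every direction.\<close>

lemma orbit_concordance_transfer:
  assumes "finite I"
    and "mset_composition (coord_mset I p) = mset_composition (coord_mset I p')"
    and "\<And>q. q \<in> orbit I p \<Longrightarrow> concordant I y q \<Longrightarrow> concordant I z q"
    and q': "q' \<in> orbit I p'" "concordant I y q'"
  shows "concordant I z q'"
proof -
  have "mset_composition (coord_mset I q') = mset_composition (coord_mset I p)"
    using q' assms(2) by (simp add: orbit_def)
  then obtain f where f: "strict_mono_on (set_mset (coord_mset I q')) f"
    "coord_mset I p = image_mset f (coord_mset I q')"
    using mset_composition_eq_imp by blast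
  have le: "f (Poly_Mapping.lookup q' i) \<le> f (Poly_Mapping.lookup q' j) \<longleftrightarrow>
      Poly_Mapping.lookup q' i \<le> Poly_Mapping.lookup q' j" if "i \<in> I" "j \<in> I" for i j
    using f(1) that assms(1) by (intro strict_mono_on_leD[THEN iffI] strict_mono_on_less_eq)
      (auto simp: set_coord_mset)
  define q where "q = point I (f \<circ> Poly_Mapping.lookup q')"
  have "q \<in> orbit I p"
    unfolding orbit_def using f(2) assms(1)
    by (simp add: q_def point_in_point_space coord_mset_point) (simp add: coord_mset_def o_def multiset.map_comp)
  moreover have conc: "concordant I x q \<longleftrightarrow> concordant I x q'" for x
    using le assms(1) by (simp add: concordant_def q_def lookup_point)
  ultimately show ?thesis using assms(3) q'(2) by blast
qed

lemma orbit_polytopes_normal_fan_eq: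
  assumes "finite I" "p \<in> point_space I" "p' \<in> point_space I"
    and "point_composition I p = point_composition I p'"
  shows "normal_fan I (orbit_polytope I p) = normal_fan I (orbit_polytope I p')"
proof -
  have c: "mset_composition (coord_mset I p) = mset_composition (coord_mset I p')"
    using assms(4) by (simp add: point_composition_eq[OF assms(1)])
  show ?thesis
    unfolding normal_fan_eq_iff[OF assms(1) polytope_in_orbit_polytope[OF assms(1,2)]
        polytope_in_orbit_polytope[OF assms(1,3)]]
      orbit_polytope_maximizers_subset_iff[OF assms(1,2)]
      orbit_polytope_maximizers_subset_iff[OF assms(1,3)]
    using orbit_concordance_transfer[OF assms(1) c] orbit_concordance_transfer[OF assms(1) c[symmetric]]
    by blast
qed

text \<open>All points of the orbit have the same sum of squares, so one whose pairing with
  \<open>p\<close> equals that of \<open>p\<close> itself has distance zero from \<open>p\<close>;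
  the direction \<open>p\<close> therefore exposes \<open>p\<close>. An actual vertex keeps
  \<open>has_composition\<close> from holding vacuously.\<close>

lemma extreme_point_orbit_polytope:
  assumes "finite I" "p \<in> point_space I"
  shows "p extreme_point_of orbit_polytope I p"
proof -
  let ?l = Poly_Mapping.lookup
  let ?f = "pairing I (?l p)"
  have p: "p \<in> maximizers ?f (orbit I p)"
    unfolding maximizers_orbit[OF assms(1)] using orbit_self[OF assms(2)] by (auto simp: concordant_def)
  have "q = p" if "q \<in> maximizers ?f (orbit I p)" for q
  proof -
    have qo: "q \<in> orbit I p" using that by (simp add: maximizers_def)
    have "?f q = ?f p" using that maximizers_eq_level[OF p] by blast
    moreover have "(\<Sum>i\<in>I. (?l q i)\<^sup>2) = (\<Sum>i\<in>I. (?l p i)\<^sup>2)"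
    proof -
      have "(\<Sum>i\<in>I. (?l r i)\<^sup>2) = (\<Sum>x\<in>#coord_mset I r. x\<^sup>2)" for r
        by (simp add: coord_mset_def sum_unfold_sum_mset multiset.map_comp o_def)
      then show ?thesis using qo by (simp add: orbit_def)
    qed
    ultimately have "(\<Sum>i\<in>I. (?l p i - ?l q i)\<^sup>2) = 0"
      by (simp add: power2_diff sum.distrib sum_subtractf pairing_def sum_distrib_left[symmetric]
          mult.assoc) (simp add: power2_eq_square)
    then have "\<forall>i\<in>I. (?l p i - ?l q i)\<^sup>2 = 0"
      using assms(1) by (subst (asm) sum_nonneg_eq_0_iff) auto
    then show ?thesis
      using qo assms(2) by (intro point_space_eqI[of _ I]) (auto simp: orbit_def)
  qed
  then have "maximizers ?f (orbit I p) = {p}" using p by blast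
  then have "maximizers ?f (orbit_polytope I p) = {p}"
    using maximizers_hull[OF linear_pairing finite_orbit[OF assms], of I "?l p"]
    by (simp add: orbit_polytope_eq_hull[OF assms])
  then have "{p} face_of orbit_polytope I p"
    using maximizers_face_of[OF linear_pairing, of "orbit_polytope I p" I "?l p"]
    by (simp add: orbit_polytope_eq_hull[OF assms])
  then show ?thesis by (simp add: face_of_singleton)
qed

lemma has_composition_orbit_polytope_iff:
  assumes "finite I" "p \<in> point_space I"
  shows "has_composition I (orbit_polytope I p) \<alpha> \<longleftrightarrow> point_composition I p = \<alpha>"
proof
  assume "has_composition I (orbit_polytope I p) \<alpha>"
  then show "point_composition I p = \<alpha>"
    using extreme_point_orbit_polytope[OF assms] by (simp add: has_composition_def)
next
  assume c: "point_composition I p = \<alpha>"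
  have "point_composition I v = \<alpha>" if "v extreme_point_of orbit_polytope I p" for v
  proof -
    have "v \<in> orbit I p"
      using that extreme_point_of_convex_hull by (simp add: orbit_polytope_eq_hull[OF assms])
    then show ?thesis using c by (simp add: point_composition_eq[OF assms(1)] orbit_def)
  qed
  then show "has_composition I (orbit_polytope I p) \<alpha>" by (simp add: has_composition_def)
qed

lemma ex_point_composition:
  assumes "finite I" "is_composition (card I) \<alpha>"
  shows "\<exists>p\<in>point_space I. point_composition I p = \<alpha>"
proof -
  obtain M :: "real multiset" where M: "size M = card I" "mset_composition M = \<alpha>"
    using ex_mset_composition[OF assms(2)] by blast
  obtain xs where xs: "mset xs = M" using ex_mset by blast
  obtain h where h: "bij_betw h I {0..<card I}"
    using ex_bij_betw_finite_nat[OF assms(1)] by blast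
  have len: "length xs = card I" using xs M(1) by auto
  have "image_mset (\<lambda>i. xs ! h i) (mset_set I) = image_mset (nth xs) (image_mset h (mset_set I))"
    by (simp add: multiset.map_comp o_def)
  also have "image_mset h (mset_set I) = mset_set {..<card I}"
    using h by (simp add: image_mset_mset_set bij_betw_def lessThan_atLeast0)
  also have "image_mset (nth xs) \<dots> = mset (map (nth xs) [0..<length xs])"
    by (simp add: mset_set_upto_eq_mset_upto len)
  finally have "coord_mset I (point I (\<lambda>i. xs ! h i)) = M"
    using assms(1) xs by (simp add: coord_mset_point map_nth del: mset_map)
  then show ?thesis
    using M(2) assms(1) by (intro bexI[of _ "point I (\<lambda>i. xs ! h i)"])
      (simp_all add: point_composition_eq point_in_point_space)
qed

subsection \<open>The maximal face of a product of orbit polytopes\<close>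

lemma poly_prod_eq_set_plus: "poly_prod A B = A + B"
  by (auto simp: poly_prod_def set_plus_def)

lemma coord_mset_point_lookup: "finite S \<Longrightarrow> coord_mset S (point S (Poly_Mapping.lookup p)) = coord_mset S p"
  by (simp add: coord_mset_point) (simp add: coord_mset_def)

lemma maximizers_indicator_orbit:
  assumes "finite S" "finite T" "S \<inter> T = {}"
  shows "maximizers (pairing (S \<union> T) (indicator S)) (orbit (S \<union> T) p) =
    {q \<in> orbit (S \<union> T) p. \<forall>s\<in>S. \<forall>t\<in>T. Poly_Mapping.lookup q t \<le> Poly_Mapping.lookup q s}"
proof -
  have "concordant (S \<union> T) (indicator S) q \<longleftrightarrow>
      (\<forall>s\<in>S. \<forall>t\<in>T. Poly_Mapping.lookup q t \<le> Poly_Mapping.lookup q s)" for q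
    using assms(3) by (auto simp: concordant_def indicator_def)
  then show ?thesis using assms by (simp add: maximizers_orbit)
qed

text \<open>Any maximizer of the coordinate sum over \<open>S\<close> will do, which avoids
  constructing a sorted rearrangement.\<close>

lemma ex_dominant_in_orbit:
  assumes "finite S" "finite T" "S \<inter> T = {}" "p \<in> point_space (S \<union> T)"
  shows "\<exists>q\<in>orbit (S \<union> T) p. \<forall>s\<in>S. \<forall>t\<in>T. Poly_Mapping.lookup q t \<le> Poly_Mapping.lookup q s"
proof -
  have "finite (orbit (S \<union> T) p)" "orbit (S \<union> T) p \<noteq> {}"
    using finite_orbit[of "S \<union> T" p] orbit_self[OF assms(4)] assms by auto
  then have "maximizers (pairing (S \<union> T) (indicator S)) (orbit (S \<union> T) p) \<noteq> {}"
    by (rule maximizers_nonempty)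
  then show ?thesis unfolding maximizers_indicator_orbit[OF assms(1-3)] by blast
qed

text \<open>Dominance of \<open>S\<close> over \<open>T\<close> forces the values on
  \<open>S\<close> to be the \<open>card S\<close> largest ones, with multiplicity. The remaining
  freedom is an independent rearrangement on each side, and such rearrangements keep the two sets of
  values and hence dominance.\<close>

lemma dominant_orbit_eq:
  assumes fin: "finite S" "finite T" and disj: "S \<inter> T = {}"
    and dom: "\<And>s t. s \<in> S \<Longrightarrow> t \<in> T \<Longrightarrow> Poly_Mapping.lookup p t \<le> Poly_Mapping.lookup p s"
  shows "{q \<in> orbit (S \<union> T) p. \<forall>s\<in>S. \<forall>t\<in>T. Poly_Mapping.lookup q t \<le> Poly_Mapping.lookup q s} =
    poly_prod (orbit S (point S (Poly_Mapping.lookup p))) (orbit T (point T (Poly_Mapping.lookup p)))"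
    (is "?L = ?R")
proof (intro equalityI subsetI)
  fix q assume q: "q \<in> ?L"
  let ?s = "point S (Poly_Mapping.lookup q)" and ?t = "point T (Poly_Mapping.lookup q)"
  have "coord_mset S q + coord_mset T q = coord_mset S p + coord_mset T p"
    using q coord_mset_Un[OF fin disj] by (simp add: orbit_def)
  moreover from this have "coord_mset S q = coord_mset S p"
    using q dom fin by (elim mset_split_unique) (auto simp: size_coord_mset set_coord_mset)
  ultimately have "?s \<in> orbit S (point S (Poly_Mapping.lookup p))"
    "?t \<in> orbit T (point T (Poly_Mapping.lookup p))"
    using fin by (simp_all add: orbit_def coord_mset_point_lookup point_in_point_space)
  moreover have "q = ?s + ?t"
  proof (rule poly_mapping_eqI)
    fix i
    have "Poly_Mapping.lookup q i = 0" if "i \<notin> S \<union> T"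
      using q that by (auto simp: orbit_def intro: lookup_eq_0_outside)
    then show "Poly_Mapping.lookup q i = Poly_Mapping.lookup (?s + ?t) i"
      using disj fin by (auto simp: lookup_add lookup_point)
  qed
  ultimately show "q \<in> ?R" unfolding poly_prod_def by blast
next
  fix q assume "q \<in> ?R"
  then obtain a b where ab: "q = a + b" "a \<in> orbit S (point S (Poly_Mapping.lookup p))"
    "b \<in> orbit T (point T (Poly_Mapping.lookup p))"
    by (auto simp: poly_prod_def)
  have ps: "a \<in> point_space S" "b \<in> point_space T" using ab by (auto simp: orbit_def)
  have eq: "Poly_Mapping.lookup q i = (if i \<in> S then Poly_Mapping.lookup a i else Poly_Mapping.lookup b i)" for i
    using disj ab(1) lookup_eq_0_outside[OF ps(1), of i] lookup_eq_0_outside[OF ps(2), of i]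
    by (auto simp: lookup_add)
  have S: "coord_mset S q = coord_mset S p"
  proof -
    have "coord_mset S q = coord_mset S a"
      unfolding coord_mset_def using eq fin by (intro image_mset_cong) auto
    then show ?thesis using ab(2) coord_mset_point_lookup[OF fin(1)] by (simp add: orbit_def)
  qed
  have T: "coord_mset T q = coord_mset T p"
  proof -
    have "coord_mset T q = coord_mset T b"
      unfolding coord_mset_def using eq disj fin by (intro image_mset_cong) auto
    then show ?thesis using ab(3) coord_mset_point_lookup[OF fin(2)] by (simp add: orbit_def)
  qed
  have "q \<in> point_space (S \<union> T)"
    using ps eq by (intro point_spaceI) (auto simp: lookup_eq_0_outside)
  moreover have "coord_mset (S \<union> T) q = coord_mset (S \<union> T) p"
    using S T coord_mset_Un[OF fin disj] by simp
  moreover have "Poly_Mapping.lookup q t \<le> Poly_Mapping.lookup q s" if "s \<in> S" "t \<in> T" for s t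
  proof -
    have "Poly_Mapping.lookup q s \<in> Poly_Mapping.lookup p ` S"
      "Poly_Mapping.lookup q t \<in> Poly_Mapping.lookup p ` T"
      using that S T fin by (metis set_coord_mset imageI)+
    then show ?thesis using dom by auto
  qed
  ultimately show "q \<in> ?L" by (simp add: orbit_def)
qed

lemma max_face_orbit_polytope:
  assumes "finite S" "finite T" "S \<inter> T = {}" "p \<in> point_space (S \<union> T)"
    and "\<And>s t. s \<in> S \<Longrightarrow> t \<in> T \<Longrightarrow> Poly_Mapping.lookup p t \<le> Poly_Mapping.lookup p s"
  shows "max_face S (orbit_polytope (S \<union> T) p) =
    poly_prod (orbit_polytope S (point S (Poly_Mapping.lookup p)))
      (orbit_polytope T (point T (Poly_Mapping.lookup p)))"
proof -
  have fin: "finite (S \<union> T)" using assms by simp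
  have "max_face S (orbit_polytope (S \<union> T) p) =
    convex hull maximizers (pairing (S \<union> T) (indicator S)) (orbit (S \<union> T) p)"
    using maximizers_hull[OF linear_pairing finite_orbit[OF fin assms(4)]]
    by (simp add: max_face_eq_maximizers[OF fin] orbit_polytope_eq_hull[OF fin assms(4)])
  also have "\<dots> = convex hull poly_prod (orbit S (point S (Poly_Mapping.lookup p)))
      (orbit T (point T (Poly_Mapping.lookup p)))"
    unfolding maximizers_indicator_orbit[OF assms(1-3)]
    using dominant_orbit_eq[OF assms(1-3,5)] by simp
  finally show ?thesis
    using assms(1,2)
    by (simp add: poly_prod_eq_set_plus convex_hull_set_plus orbit_polytope_eq_hull point_in_point_space)
qed

section \<open>Existence and uniqueness of the factorization of the maximal face\<close>

lemma orbit_product_orbit_polytope: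
  "finite I \<Longrightarrow> p \<in> point_space I \<Longrightarrow> orbit_product I (orbit_polytope I p)"
  by (simp add: orbit_product.orbit orbit_polytopes_def)

lemma orbit_product_polytope: "orbit_product I P \<Longrightarrow> finite I \<and> polytope_in I P"
  by (induction rule: orbit_product.induct)
    (auto simp: orbit_polytopes_def polytope_in_orbit_polytope polytope_in_poly_prod)

text \<open>Coordinates outside the support of a factor vanish, so each factor is maximized only
  over its own share of \<open>S\<close>.\<close>

lemma max_face_poly_prod:
  assumes "finite S" "P \<subseteq> point_space I" "Q \<subseteq> point_space J"
  shows "max_face S (poly_prod P Q) = poly_prod (max_face (S \<inter> I) P) (max_face (S \<inter> J) Q)"
proof -
  let ?f = "\<lambda>S x. \<Sum>s\<in>S. Poly_Mapping.lookup (x :: 'a \<Rightarrow>\<^sub>0 real) s"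
  have mf: "max_face S P = maximizers (?f S) P" for S :: "'a set" and P
    by (simp add: max_face_def maximizers_def)
  have "maximizers (?f S) R = maximizers (?f (S \<inter> K)) R" if "R \<subseteq> point_space K" for R K
    using that assms(1)
    by (intro maximizers_cong sum.mono_neutral_right) (auto intro: lookup_eq_0_outside)
  moreover have "maximizers (?f S) (poly_prod P Q) = poly_prod (maximizers (?f S) P) (maximizers (?f S) Q)"
    by (rule maximizers_poly_prod) (simp add: lookup_add sum.distrib)
  ultimately show ?thesis using assms by (simp add: mf)
qed

text \<open>An orbit polytope is also generated by a dominant point of its orbit, whose projections
  give the factors. A product cuts \<open>S\<close> and \<open>T\<close> into shares, so the
  induction varies them; the four resulting pieces are regrouped by commutativity of the
  sum.\<close>

lemma ex_max_face_split:
  assumes "orbit_product I P" "I = S \<union> T" "S \<inter> T = {}"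
  shows "\<exists>A B. orbit_product S A \<and> orbit_product T B \<and> max_face S P = poly_prod A B"
  using assms
proof (induction arbitrary: S T rule: orbit_product.induct)
  case (orbit I P)
  then obtain p where p: "p \<in> point_space (S \<union> T)" "P = orbit_polytope (S \<union> T) p"
    by (auto simp: orbit_polytopes_def)
  have fin: "finite S" "finite T" using orbit by auto
  obtain q where q: "q \<in> orbit (S \<union> T) p"
    "\<And>s t. s \<in> S \<Longrightarrow> t \<in> T \<Longrightarrow> Poly_Mapping.lookup q t \<le> Poly_Mapping.lookup q s"
    using ex_dominant_in_orbit[OF fin orbit(4) p(1)] by blast
  then have qs: "q \<in> point_space (S \<union> T)" by (simp add: orbit_def)
  have "P = orbit_polytope (S \<union> T) q"
    using p qs fin by (simp add: orbit_polytope_eq_hull orbit_eq[OF q(1)])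
  then show ?case
    using max_face_orbit_polytope[OF fin orbit(4) qs q(2)] fin
    by (metis orbit_product_orbit_polytope point_in_point_space)
next
  case (prod S1 P T1 Q)
  have fin: "finite S" using orbit_product_polytope[OF prod(1)] orbit_product_polytope[OF prod(2)] prod.prems(1)
    by (metis finite_Un)
  have "\<exists>A B. orbit_product (S \<inter> S1) A \<and> orbit_product (T \<inter> S1) B \<and> max_face (S \<inter> S1) P = poly_prod A B"
    using prod.prems by (intro prod.IH) auto
  then obtain A1 B1 where 1: "orbit_product (S \<inter> S1) A1" "orbit_product (T \<inter> S1) B1"
    "max_face (S \<inter> S1) P = poly_prod A1 B1" by blast
  have "\<exists>A B. orbit_product (S \<inter> T1) A \<and> orbit_product (T \<inter> T1) B \<and> max_face (S \<inter> T1) Q = poly_prod A B"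
    using prod.prems by (intro prod.IH) auto
  then obtain A2 B2 where 2: "orbit_product (S \<inter> T1) A2" "orbit_product (T \<inter> T1) B2"
    "max_face (S \<inter> T1) Q = poly_prod A2 B2" by blast
  have "max_face S (poly_prod P Q) = poly_prod (poly_prod A1 B1) (poly_prod A2 B2)"
    using max_face_poly_prod[OF fin] orbit_product_polytope[OF prod(1)] orbit_product_polytope[OF prod(2)]
      1(3) 2(3) by (metis polytope_in_subset)
  also have "\<dots> = poly_prod (poly_prod A1 A2) (poly_prod B1 B2)"
    unfolding poly_prod_eq_set_plus by (simp add: ac_simps)
  finally have "max_face S (poly_prod P Q) = poly_prod (poly_prod A1 A2) (poly_prod B1 B2)" .
  moreover have "orbit_product S (poly_prod A1 A2)"
    using orbit_product.prod[OF 1(1) 2(1)] prod.hyps prod.prems(1)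
    by (metis Int_Un_distrib Int_assoc Int_commute Int_empty_right Un_Int_eq(3) inf_sup_absorb)
  moreover have "orbit_product T (poly_prod B1 B2)"
    using orbit_product.prod[OF 1(2) 2(2)] prod.hyps prod.prems(1)
    by (metis Int_Un_distrib Int_assoc Int_commute Int_empty_right Un_Int_eq(4) inf_sup_absorb)
  ultimately show ?case by blast
qed

text \<open>Equality of two products gives inclusions of the factors in both directions, so the
  definite description in \<open>split_face\<close> has a unique witness.\<close>

lemma split_face_eqI:
  assumes "orbit_product S A" "orbit_product T B" "S \<inter> T = {}" "max_face S P = poly_prod A B"
  shows "split_face S T P = (A, B)"
proof -
  have "A' = A \<and> B' = B"
    if "orbit_product S A'" "orbit_product T B'" "max_face S P = poly_prod A' B'" for A' B'
  proof -
    have "poly_prod A' B' = poly_prod A B" using that assms(4) by simp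
    then show ?thesis
      using poly_prod_subset_iff[of A' S A B' T B] poly_prod_subset_iff[of A S A' B T B']
        orbit_product_polytope that(1,2) assms(1-3) polytope_in_subset polytope_in_nonempty
      by (metis subset_antisym order_refl)
  qed
  then show ?thesis
    unfolding split_face_def using assms by (intro the_equality) auto
qed

subsection \<open>The coproduct of an orbit class\<close>

lemma normal_class_eqI:
  assumes "orbit_product I P" "orbit_product I Q" "normal_fan I P = normal_fan I Q"
  shows "normal_class I P = normal_class I Q"
  using assms by (simp add: normal_class_def normal_equiv_def)

lemma normal_class_in_OP_bar: "orbit_product I P \<Longrightarrow> normal_class I P \<in> OP_bar I"
  by (simp add: OP_bar_def normal_class_def quotientI)

text \<open>All orbit polytopes with this composition share one fan, so the image defining
  \<open>orbit_class\<close> is a nonempty union of copies of a single class.\<close>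

lemma orbit_class_eq:
  assumes "finite I" "p \<in> point_space I"
  shows "orbit_class I (point_composition I p) = normal_class I (orbit_polytope I p)"
proof -
  have "normal_fan I P = normal_fan I (orbit_polytope I p)"
    if P: "P \<in> orbit_polytopes I" "has_composition I P (point_composition I p)" for P
  proof -
    obtain p' where p': "p' \<in> point_space I" "P = orbit_polytope I p'"
      using P(1) by (auto simp: orbit_polytopes_def)
    then have "point_composition I p' = point_composition I p"
      using P(2) has_composition_orbit_polytope_iff[OF assms(1)] by simp
    then show ?thesis using orbit_polytopes_normal_fan_eq[OF assms(1)] p' assms(2) by blast
  qed
  then have "normal_class I P = normal_class I (orbit_polytope I p)"
    if "P \<in> {P \<in> orbit_polytopes I. has_composition I P (point_composition I p)}" for P
    using that assms by (intro normal_class_eqI) (auto simp: orbit_product.orbit orbit_product_orbit_polytope)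
  moreover have "orbit_polytope I p \<in> {P \<in> orbit_polytopes I. has_composition I P (point_composition I p)}"
    using assms by (simp add: orbit_polytopes_def has_composition_orbit_polytope_iff)
  ultimately show ?thesis
    unfolding orbit_class_def Image_eq_UN[of _ "{P \<in> orbit_polytopes I. _ P}"] normal_class_def[symmetric]
    by blast
qed

text \<open>For an arbitrary representative \<open>Q\<close> the factors of the maximal face are
  known only to exist, but their fans agree with those of \<open>A\<close> and \<open>B\<close>. The
  map under \<open>the_elem\<close> is thus constant on a nonempty class.\<close>

lemma coproduct_normal_class:
  assumes "finite S" "finite T" "S \<inter> T = {}"
    and P: "orbit_product (S \<union> T) P" and A: "orbit_product S A" and B: "orbit_product T B"
    and mf: "max_face S P = poly_prod A B"
  shows "coproduct S T (normal_class (S \<union> T) P) = (normal_class S A, normal_class T B)"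
proof -
  let ?g = "\<lambda>Q. (normal_class S (fst (split_face S T Q)), normal_class T (snd (split_face S T Q)))"
  have "?g Q = (normal_class S A, normal_class T B)" if "Q \<in> normal_class (S \<union> T) P" for Q
  proof -
    have Q: "orbit_product (S \<union> T) Q" and fan: "normal_fan (S \<union> T) P = normal_fan (S \<union> T) Q"
      using that by (auto simp: normal_class_def normal_equiv_def)
    obtain A' B' where A'B': "orbit_product S A'" "orbit_product T B'" "max_face S Q = poly_prod A' B'"
      using ex_max_face_split[OF Q refl assms(3)] by blast
    have "normal_fan S A = normal_fan S A'" "normal_fan T B = normal_fan T B'"
      using normal_fan_max_face_components[OF assms(1-3) _ _ fan _ _ _ _ mf A'B'(3)]
        orbit_product_polytope P Q A B A'B'(1,2) by blast+
    then have "normal_class S A' = normal_class S A" "normal_class T B' = normal_class T B"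
      using A B A'B'(1,2) by (metis normal_class_eqI)+
    then show ?thesis
      by (simp add: split_face_eqI[OF A'B'(1,2) assms(3) A'B'(3)])
  qed
  moreover have "P \<in> normal_class (S \<union> T) P"
    using P by (simp add: normal_class_def normal_equiv_def)
  ultimately have "?g ` normal_class (S \<union> T) P = (\<lambda>_. (normal_class S A, normal_class T B)) ` normal_class (S \<union> T) P"
    "normal_class (S \<union> T) P \<noteq> {}"
    by (intro image_cong refl, blast+)
  then show ?thesis unfolding coproduct_def by (simp add: image_constant_conv)
qed

theorem proposition4p18:
  fixes I S T :: "'a set" and n :: nat and \<alpha> :: "nat list"
  assumes "finite I" and "card I = n" and "is_composition n \<alpha>"
    and "I = S \<union> T" and "S \<inter> T = {}"
  shows "orbit_class I \<alpha> \<in> OP_bar I \<and>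
    (\<exists>!\<beta>\<gamma>. splits_composition \<alpha> (card S) (card T) (fst \<beta>\<gamma>) (snd \<beta>\<gamma>)) \<and>
    (\<forall>\<beta> \<gamma>. splits_composition \<alpha> (card S) (card T) \<beta> \<gamma> \<longrightarrow>
       orbit_class S \<beta> \<in> OP_bar S \<and> orbit_class T \<gamma> \<in> OP_bar T \<and>
       coproduct S T (orbit_class I \<alpha>) = (orbit_class S \<beta>, orbit_class T \<gamma>))"
proof -
  have fin: "finite S" "finite T" using assms(1,4) by auto
  obtain p0 where p0: "p0 \<in> point_space I" "point_composition I p0 = \<alpha>"
    using ex_point_composition assms(1-3) by blast
  \<comment> \<open>Passing to a rearrangement that is large on \<open>S\<close> changes neither the
    composition nor the class, and makes the factors of the maximal face the orbit polytopes of its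
    two projections.\<close>
  obtain p where p: "p \<in> orbit I p0"
    and dom: "\<And>s t. s \<in> S \<Longrightarrow> t \<in> T \<Longrightarrow> Poly_Mapping.lookup p t \<le> Poly_Mapping.lookup p s"
    using ex_dominant_in_orbit[OF fin assms(5)] p0(1) assms(4) by blast
  have ps: "p \<in> point_space (S \<union> T)" and pc: "point_composition I p = \<alpha>"
    using p p0 assms(1,4) by (auto simp: orbit_def point_composition_eq)
  define pS pT where "pS = point S (Poly_Mapping.lookup p)" and "pT = point T (Poly_Mapping.lookup p)"
  have pS: "pS \<in> point_space S" and pT: "pT \<in> point_space T"
    using fin by (simp_all add: pS_def pT_def point_in_point_space)
  define b c where "b = point_composition S pS" and "c = point_composition T pT"
  have "splits_composition (mset_composition (coord_mset S p + coord_mset T p))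
      (size (coord_mset S p)) (size (coord_mset T p))
      (mset_composition (coord_mset S p)) (mset_composition (coord_mset T p))"
    using dom fin by (intro splits_mset_composition) (auto simp: set_coord_mset)
  then have split: "splits_composition \<alpha> (card S) (card T) b c"
    using pc fin assms(1,5) unfolding assms(4) b_def c_def pS_def pT_def
    by (simp add: point_composition_eq coord_mset_point_lookup coord_mset_Un size_coord_mset)
  have cl: "orbit_class I \<alpha> = normal_class (S \<union> T) (orbit_polytope (S \<union> T) p)"
    "orbit_class S b = normal_class S (orbit_polytope S pS)"
    "orbit_class T c = normal_class T (orbit_polytope T pT)"
    using orbit_class_eq fin ps pS pT pc assms(1,4) unfolding b_def c_def by blast+
  have op: "orbit_product (S \<union> T) (orbit_polytope (S \<union> T) p)"
    "orbit_product S (orbit_polytope S pS)" "orbit_product T (orbit_polytope T pT)"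
    using fin ps pS pT by (simp_all add: orbit_product_orbit_polytope)
  have "coproduct S T (orbit_class I \<alpha>) = (orbit_class S b, orbit_class T c)"
    unfolding cl using max_face_orbit_polytope[OF fin assms(5) ps dom]
    by (intro coproduct_normal_class fin assms(5) op) (simp add: pS_def pT_def)
  moreover have "orbit_class I \<alpha> \<in> OP_bar I" "orbit_class S b \<in> OP_bar S" "orbit_class T c \<in> OP_bar T"
    using normal_class_in_OP_bar[OF op(1)] normal_class_in_OP_bar[OF op(2)]
      normal_class_in_OP_bar[OF op(3)] cl assms(4) by simp_all
  \<comment> \<open>Uniqueness also transfers the formula, obtained for the compositions of the
    projections, to every split of \<open>\<alpha>\<close>.\<close>
  moreover have uniq: "\<beta> = b \<and> \<gamma> = c" if "splits_composition \<alpha> (card S) (card T) \<beta> \<gamma>" for \<beta> \<gamma>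
    using splits_composition_unique that split by blast
  moreover have "\<exists>!\<beta>\<gamma>. splits_composition \<alpha> (card S) (card T) (fst \<beta>\<gamma>) (snd \<beta>\<gamma>)"
  proof (rule ex1I[of _ "(b, c)"])
    show "x = (b, c)" if "splits_composition \<alpha> (card S) (card T) (fst x) (snd x)" for x
      using uniq[OF that] by (simp add: prod_eq_iff)
  qed (simp add: split)
  ultimately show ?thesis by blast
qed

end
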